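(* Thompson's group $V$ is not invariably generated.
   Context: $S^1$ is the interval $[0,1]$ with $0$ and $1$ identified. Thompson's group $V$ is the group of left-continuous bijections of $S^1$ which map finite dyadic fractions to finite dyadic fractions, are differentiable except at finitely many finite dyadic fractions, and on each maximal interval of differentiability are linear with slope an integer power of $2$. A group $G$ is invariably generated if there is a subset $S\subseteq G$ such that $G=\langle s^{g(s)}: s\in S\rangle$ for every choice of $g(s)\in G$, $s\in S$; equivalently, no proper subgroup of $G$ meets every conjugacy class of $G$. *)

theory Defs
  imports Complex_Main "HOL-Algebra.Algebra"
begin

text \<open>The circle S^1 is represented by the half-open interval [0,1); a real y denotes
  the circle point frac y. Elements of V are functions real => real that act on [0,1)
  and are the identity outside it (so that composition and id give the group structure).\<close>

definition circ :: "real set" where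
  "circ = {0..<1}"

definition dyadic :: "real \<Rightarrow> bool" where
  "dyadic x \<longleftrightarrow> (\<exists>m::int. \<exists>n::nat. x = of_int m / 2 ^ n)"

definition cdist :: "real \<Rightarrow> real \<Rightarrow> real" where
  "cdist a b = min \<bar>a - b\<bar> (1 - \<bar>a - b\<bar>)"

definition thompsonV :: "(real \<Rightarrow> real) set" where
  "thompsonV = {f.
     bij_betw f circ circ \<and>
     (\<forall>x. x \<notin> circ \<longrightarrow> f x = x) \<and>
     (\<forall>x\<in>circ. dyadic x \<longrightarrow> dyadic (f x)) \<and>
     (\<forall>x\<in>circ. \<forall>e>0. \<exists>d>0. \<forall>t. 0 < t \<and> t < d \<longrightarrow> cdist (f (frac (x - t))) (f x) < e) \<and>
     (\<exists>B. finite B \<and> B \<subseteq> circ \<and> (\<forall>b\<in>B. dyadic b) \<and>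
        (\<forall>x\<in>circ - B. \<exists>e>0. \<exists>k::int. \<exists>c::real.
            \<forall>y. \<bar>y - x\<bar> < e \<longrightarrow> f (frac y) = frac (2 powi k * y + c)))}"

definition V_group :: "(real \<Rightarrow> real) monoid" where
  "V_group = \<lparr>carrier = thompsonV, monoid.mult = (\<circ>), one = id\<rparr>"

definition invariably_generated :: "('a, 'b) monoid_scheme \<Rightarrow> bool" where
  "invariably_generated G \<longleftrightarrow>
     (\<exists>S \<subseteq> carrier G. \<forall>g \<in> S \<rightarrow> carrier G.
        generate G ((\<lambda>s. inv\<^bsub>G\<^esub> (g s) \<otimes>\<^bsub>G\<^esub> s \<otimes>\<^bsub>G\<^esub> g s) ` S) = carrier G)"

end

theory Submission
  imports Defs "HOL-Library.Countable_Set"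
begin

text \<open>
  Call a set thin for f if every f-orbit meets it at most once. Every element f of V has a thin
  dyadic interval: follow a dyadic point q. If its orbit is infinite, f eventually maps a small
  dyadic interval ending at the orbit point to dyadic intervals forever, and either this interval
  or a part of it that avoids its first return is wandering. If q is periodic, replace f by its
  inverse if necessary so that the return map at q is not expanding, and use either a neighbourhood
  of q on which it is the identity or a fundamental domain of the contraction.

  V acts so flexibly that a conjugate of f has a thin set whose complement lies in any prescribed
  dyadic interval. As V is countable, we can choose pairwise disjoint intervals U(f) and conjugates
  c(f) such that every c(f)-orbit meets the complement of U(f) at most once. By a ping-pong
  argument, an orbit of the group generated by all c(f) contains at most one point outside the
  union of the U(f), so this group is not transitive on the dyadic points, whereas V is.
\<close>

subsection \<open>Dyadic intervals\<close>

lemma frac_eq_frac_iff: "frac x = frac (y::real) \<longleftrightarrow> x - y \<in> \<int>"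
proof
  assume "frac x = frac y"
  then have "x - y = of_int (\<lfloor>x\<rfloor> - \<lfloor>y\<rfloor>)" by (simp add: frac_def)
  then show "x - y \<in> \<int>" by (metis Ints_of_int)
next
  assume "x - y \<in> \<int>"
  then have "frac (y + (x - y)) = frac y" by (rule frac_add_int_right)
  then show "frac x = frac y" by simp
qed

lemma frac_in_circ [simp]: "frac x \<in> circ"
  by (simp add: circ_def frac_lt_1)

lemma frac_circ [simp]: "x \<in> circ \<Longrightarrow> frac x = x"
  by (simp add: circ_def)

lemma frac_diff_cong: "frac x = frac y \<Longrightarrow> frac (x - t) = frac (y - t :: real)"
  by (simp add: frac_eq_frac_iff)

lemma frac_frac_diff [simp]: "frac (frac x - t) = frac (x - t :: real)"
  by (rule frac_diff_cong) simp

text \<open>Formulated for real representatives rather than for points of \<open>circ\<close>, so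
  that lifts such as 1 or negative numbers may serve as endpoints; integer shifts do not affect
  it.\<close>

definition lev :: "nat \<Rightarrow> real \<Rightarrow> bool" where
  "lev n q \<longleftrightarrow> 2 ^ n * q \<in> \<int>"

text \<open>The intervals are closed on the right because elements of V are left-continuous:
  \<open>dcone n q\<close> is the image in the circle of \<open>(q - 1 / 2 ^ n, q]\<close>.\<close>

definition dcone :: "nat \<Rightarrow> real \<Rightarrow> real set" where
  "dcone n q = {frac (q - t / 2 ^ n) | t. 0 \<le> t \<and> t < 1}"

text \<open>Sharing the parameter \<open>t\<close> forces slope \<open>2 ^ n / 2 ^ m\<close> and
  sends right endpoint to right endpoint, so an affine piece is described by two levels and two
  endpoints alone.\<close>

definition cone_map :: "(real \<Rightarrow> real) \<Rightarrow> nat \<Rightarrow> real \<Rightarrow> nat \<Rightarrow> real \<Rightarrow> bool" where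
  "cone_map f n q m p \<longleftrightarrow> lev n q \<and> lev m p \<and>
     (\<forall>t. 0 \<le> t \<longrightarrow> t < 1 \<longrightarrow> f (frac (q - t / 2 ^ n)) = frac (p - t / 2 ^ m))"

lemma lev_mono: "lev n q \<Longrightarrow> n \<le> m \<Longrightarrow> lev m q"
proof -
  assume a: "lev n q" "n \<le> m"
  have "2 ^ m * q = 2 ^ (m - n) * (2 ^ n * q)"
    using a(2) by (simp add: mult.assoc[symmetric] power_add[symmetric])
  moreover have "2 ^ (m - n) * (2 ^ n * q) \<in> \<int>" using a(1) unfolding lev_def
    by (rule Ints_mult[rotated]) simp
  ultimately show ?thesis unfolding lev_def by metis
qed

lemma lev_diff: "lev n q \<Longrightarrow> lev n p \<Longrightarrow> lev n (q - p)"
  by (simp add: lev_def right_diff_distrib)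

lemma lev_add: "lev n q \<Longrightarrow> lev n p \<Longrightarrow> lev n (q + p)"
  by (simp add: lev_def distrib_left)

lemma lev_Ints: "x \<in> \<int> \<Longrightarrow> lev n x"
  by (simp add: lev_def)

lemma lev_int_div: "lev n (of_int j / 2 ^ n)"
  by (simp add: lev_def)

lemma lev_inv_power: "lev n (1 / 2 ^ n)"
  by (simp add: lev_def)

lemma lev_frac [simp]: "lev n (frac q) \<longleftrightarrow> lev n q"
proof -
  have "q = frac q + of_int \<lfloor>q\<rfloor>" "frac q = q - of_int \<lfloor>q\<rfloor>" by (auto simp: frac_def)
  then show ?thesis by (metis Ints_of_int lev_Ints lev_add lev_diff)
qed

lemma lev_cong: "frac q = frac p \<Longrightarrow> lev n q \<longleftrightarrow> lev n p"
  by (metis lev_frac)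

lemma dyadic_iff_lev: "dyadic x \<longleftrightarrow> (\<exists>n. lev n x)"
proof
  assume "dyadic x"
  then show "\<exists>n. lev n x" by (auto simp: dyadic_def intro: lev_int_div)
next
  assume "\<exists>n. lev n x"
  then obtain n m where "2 ^ n * x = of_int m" by (auto simp: lev_def elim: Ints_cases)
  then have "x = of_int m / 2 ^ n" by (simp add: field_simps)
  then show "dyadic x" by (auto simp: dyadic_def)
qed

lemma finite_lev: "finite {x \<in> circ. lev n x}"
proof -
  have "{x \<in> circ. lev n x} \<subseteq> (\<lambda>j::int. of_int j / 2 ^ n) ` {0..2 ^ n}"
  proof
    fix x assume "x \<in> {x \<in> circ. lev n x}"
    then obtain j where j: "2 ^ n * x = of_int j" and x: "0 \<le> x" "x < 1"
      by (auto simp: lev_def circ_def elim: Ints_cases)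
    have "of_int j \<ge> (0::real)" "of_int j \<le> (2 ^ n :: real)"
      using x by (simp_all flip: j)
    then have "j \<ge> 0" "j \<le> 2 ^ n" by (simp_all)
    moreover have "x = of_int j / 2 ^ n" using j by (simp add: field_simps)
    ultimately show "x \<in> (\<lambda>j::int. of_int j / 2 ^ n) ` {0..2 ^ n}" by auto
  qed
  then show ?thesis by (rule finite_subset) simp
qed

lemma cone_cong: "frac q = frac p \<Longrightarrow> dcone n q = dcone n p"
  unfolding dcone_def using frac_diff_cong by metis

lemma mem_cone_self: "frac q \<in> dcone n q"
  by (force simp: dcone_def)

lemma cone_subset_circ: "dcone n q \<subseteq> circ"
  by (auto simp: dcone_def)

text \<open>The integer \<open>z\<close> selects the right lift of the circle point, which turns
  membership into linear inequalities on the real line.\<close>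

lemma mem_cone_iff:
  "frac x \<in> dcone n q \<longleftrightarrow> (\<exists>z\<in>\<int>. 0 \<le> q - x + z \<and> q - x + z < 1 / 2 ^ n)"
proof
  assume "frac x \<in> dcone n q"
  then obtain t where t: "frac x = frac (q - t / 2 ^ n)" "0 \<le> t" "t < 1"
    by (auto simp: dcone_def)
  have "x - (q - t / 2 ^ n) \<in> \<int>" using t(1) by (simp add: frac_eq_frac_iff)
  moreover have "q - x + (x - (q - t / 2 ^ n)) = t / 2 ^ n" by simp
  ultimately show "\<exists>z\<in>\<int>. 0 \<le> q - x + z \<and> q - x + z < 1 / 2 ^ n"
    using t(2,3) by (metis divide_nonneg_pos divide_strict_right_mono zero_less_numeral zero_less_power)
next
  assume "\<exists>z\<in>\<int>. 0 \<le> q - x + z \<and> q - x + z < 1 / 2 ^ n"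
  then obtain z where z: "z \<in> \<int>" "0 \<le> q - x + z" "q - x + z < 1 / 2 ^ n" by auto
  have "frac x = frac (q - (2 ^ n * (q - x + z)) / 2 ^ n)"
    using z(1) by (simp add: frac_eq_frac_iff)
  moreover have "0 \<le> 2 ^ n * (q - x + z)" "2 ^ n * (q - x + z) < 1"
    using z(2,3) by (simp_all add: pos_less_divide_eq mult.commute)
  ultimately show "frac x \<in> dcone n q" unfolding dcone_def by blast
qed

lemma cone_cover:
  obtains q where "lev n q" "frac x \<in> dcone n q" "x \<le> q" "q < x + 1 / 2 ^ n"
proof
  \<comment> \<open>Rounding goes up because the intervals contain their right endpoints.\<close>
  let ?q = "of_int \<lceil>2 ^ n * x\<rceil> / 2 ^ n :: real"
  show "lev n ?q" by (rule lev_int_div)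
  show a: "x \<le> ?q" using le_of_int_ceiling[of "2 ^ n * x"] by (simp add: field_simps)
  have "of_int \<lceil>2 ^ n * x\<rceil> < 2 ^ n * x + 1" by linarith
  then show b: "?q < x + 1 / 2 ^ n" by (simp add: field_simps)
  show "frac x \<in> dcone n ?q" using a b by (auto simp: mem_cone_iff intro!: bexI[of _ 0])
qed

text \<open>Multiples of \<open>1 / 2 ^ n\<close> are discrete, so a strict inequality with a slack
  of one mesh is a weak one without slack. Endpoint comparisons between half-open intervals reduce
  to this.\<close>

lemma lev_less_imp: "lev n p \<Longrightarrow> lev n q \<Longrightarrow> p < q + 1 / 2 ^ n \<Longrightarrow> p \<le> q"
proof -
  assume a: "lev n p" "lev n q" "p < q + 1 / 2 ^ n"
  then obtain i j where ij: "2 ^ n * p = of_int i" "2 ^ n * q = of_int j"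
    by (auto simp: lev_def elim!: Ints_cases)
  have "2 ^ n * p < 2 ^ n * q + 1" using a(3) by (simp add: field_simps)
  then have "i \<le> j" using ij by simp
  then have "2 ^ n * p \<le> 2 ^ n * q" using ij by simp
  then show ?thesis by simp
qed

lemma cone_nested:
  assumes q: "lev n q" and p: "lev m p" and nm: "n \<le> m" and "dcone m p \<inter> dcone n q \<noteq> {}"
  shows "dcone m p \<subseteq> dcone n q"
proof -
  from assms(4) obtain x where x: "x \<in> dcone m p" "x \<in> dcone n q" by auto
  then have xc: "frac x = x" using cone_subset_circ frac_circ by blast
  obtain y where y: "y \<in> \<int>" "0 \<le> p - x + y" "p - x + y < 1 / 2 ^ m"
    using x(1) xc mem_cone_iff by metis
  obtain z where z: "z \<in> \<int>" "0 \<le> q - x + z" "q - x + z < 1 / 2 ^ n"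
    using x(2) xc mem_cone_iff by metis
  \<comment> \<open>Both right endpoints are lifted next to the common point \<open>x\<close> and
    compared on the finer grid; \<open>le2\<close> does the same for the left endpoints.\<close>
  have le1: "p + y \<le> q + z"
    by (rule lev_less_imp[of m]) (use y z q p nm in \<open>auto intro: lev_add lev_Ints lev_mono\<close>)
  have lz: "lev m z" "lev m y" "lev m q" "lev m (1 / 2 ^ n)" "lev m (1 / 2 ^ m)"
    using y z q nm lev_inv_power by (auto intro: lev_Ints lev_mono)
  have le2: "q + z - 1 / 2 ^ n \<le> p + y - 1 / 2 ^ m"
    by (rule lev_less_imp[of m])
      (use lz p y z in \<open>auto intro!: lev_add lev_diff\<close>)
  show ?thesis
  proof
    fix w assume w: "w \<in> dcone m p"
    then have wc: "frac w = w" using cone_subset_circ frac_circ by blast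
    obtain v where v: "v \<in> \<int>" "0 \<le> p - w + v" "p - w + v < 1 / 2 ^ m"
      using w wc mem_cone_iff by metis
    have "v - y + z \<in> \<int>" using v y z by simp
    moreover have "0 \<le> q - w + (v - y + z)" "q - w + (v - y + z) < 1 / 2 ^ n"
      using le1 le2 v by linarith+
    ultimately show "w \<in> dcone n q" using wc mem_cone_iff by metis
  qed
qed

lemma cone_same_level:
  assumes "lev n q" "lev n p" "frac q \<in> dcone n p"
  shows "frac q = frac p"
proof -
  obtain z where z: "z \<in> \<int>" "0 \<le> p - q + z" "p - q + z < 1 / 2 ^ n"
    using assms(3) mem_cone_iff by metis
  have "p + z \<le> q"
    by (rule lev_less_imp[of n]) (use z assms in \<open>auto intro: lev_add lev_Ints\<close>)
  then have "q - p = z" using z by simp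
  then show ?thesis using z(1) by (simp add: frac_eq_frac_iff)
qed

lemma cone_disjoint:
  assumes "lev n q" "lev n p" "frac q \<noteq> frac p"
  shows "dcone n q \<inter> dcone n p = {}"
  using cone_nested[of n p n q] cone_same_level[OF assms(1,2)] assms mem_cone_self[of q n] by blast

lemma cone_antimono: "lev n q \<Longrightarrow> n \<le> m \<Longrightarrow> dcone m q \<subseteq> dcone n q"
  by (rule cone_nested) (use mem_cone_self[of q m] mem_cone_self[of q n] lev_mono in auto)

section \<open>Affine maps between dyadic intervals\<close>

lemma cone_map_cong: "frac q = frac q' \<Longrightarrow> frac p = frac p' \<Longrightarrow> cone_map f n q m p = cone_map f n q' m p'"
  unfolding cone_map_def using frac_diff_cong lev_cong by metis

lemma cone_map_app: "cone_map f n q m p \<Longrightarrow> f (frac q) = frac p"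
  unfolding cone_map_def by (metis diff_zero div_0 order_refl zero_less_one)

lemma cone_mapD:
  "cone_map f n q m p \<Longrightarrow> 0 \<le> t \<Longrightarrow> t < 1 \<Longrightarrow> x = q - t / 2 ^ n \<Longrightarrow> f (frac x) = frac (p - t / 2 ^ m)"
  by (simp add: cone_map_def)

lemma cone_map_image: "cone_map f n q m p \<Longrightarrow> f ` dcone n q = dcone m p"
  unfolding cone_map_def dcone_def by (force simp: image_iff)

lemma cone_map_compose: "cone_map g n q m p \<Longrightarrow> cone_map f m p l r \<Longrightarrow> cone_map (f \<circ> g) n q l r"
  unfolding cone_map_def by simp

text \<open>Restriction keeps the slope, so the target level rises by the same amount
  \<open>l - n\<close> as the source level.\<close>

lemma cone_map_refine:
  assumes f: "cone_map f n q m p" and l: "lev l r" and nl: "n \<le> l" and r: "frac r \<in> dcone n q"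
  obtains s where "cone_map f l r (m + (l - n)) s"
proof -
  obtain z where z: "z \<in> \<int>" "0 \<le> q - r + z" "q - r + z < 1 / 2 ^ n"
    using r mem_cone_iff by metis
  define d where "d = l - n"
  have l_eq: "l = n + d" using nl by (simp add: d_def)
  \<comment> \<open>The parameter of the endpoint \<open>r\<close> inside the larger
    interval.\<close>
  define t0 where "t0 = 2 ^ n * (q - r + z)"
  have t0: "0 \<le> t0" "t0 < 1" using z by (simp_all add: t0_def pos_less_divide_eq mult.commute)
  have "lev l q" "lev l z" using f nl z(1) by (auto simp: cone_map_def intro: lev_mono lev_Ints)
  then have levq: "lev l (q - r + z)" using l by (intro lev_add lev_diff)
  then have i0: "2 ^ d * t0 \<in> \<int>" by (simp add: lev_def t0_def l_eq power_add mult_ac)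
  \<comment> \<open>As a multiple of \<open>1 / 2 ^ d\<close> below 1, \<open>t0\<close> leaves room
    for a whole subinterval of parameter length \<open>1 / 2 ^ d\<close>.\<close>
  have t0d: "t0 \<le> 1 - 1 / 2 ^ d"
  proof (rule lev_less_imp[of d])
    show "lev d t0" using i0 by (simp add: lev_def)
    show "lev d (1 - 1 / 2 ^ d)" by (intro lev_diff lev_Ints lev_inv_power) simp
    show "t0 < 1 - 1 / 2 ^ d + 1 / 2 ^ d" using t0 by simp
  qed
  have levp: "lev (m + d) (p - t0 / 2 ^ m)"
  proof (rule lev_diff)
    show "lev (m + d) p" using f lev_mono[of m p "m + d"] by (auto simp: cone_map_def)
    show "lev (m + d) (t0 / 2 ^ m)" using i0 by (simp add: lev_def power_add)
  qed
  have "f (frac (r - t / 2 ^ l)) = frac ((p - t0 / 2 ^ m) - t / 2 ^ (m + d))"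
    if t: "0 \<le> t" "t < 1" for t
  proof -
    have 1: "t0 + t / 2 ^ d < 1" 
    proof -
      have "t / 2 ^ d < 1 / 2 ^ d" using t by (simp add: divide_strict_right_mono)
      then show ?thesis using t0d by simp
    qed
    have "r - t / 2 ^ l = (q - (t0 + t / 2 ^ d) / 2 ^ n) + z"
      by (simp add: t0_def l_eq power_add field_simps)
    then have "frac (r - t / 2 ^ l) = frac (q - (t0 + t / 2 ^ d) / 2 ^ n)"
      using z(1) by (simp add: frac_add_int_right)
    then have "f (frac (r - t / 2 ^ l)) = frac (p - (t0 + t / 2 ^ d) / 2 ^ m)"
      using f 1 t t0 by (simp add: cone_map_def)
    also have "p - (t0 + t / 2 ^ d) / 2 ^ m = (p - t0 / 2 ^ m) - t / 2 ^ (m + d)"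
      by (simp add: power_add field_simps)
    finally show ?thesis .
  qed
  then have "cone_map f l r (m + d) (p - t0 / 2 ^ m)" using l levp by (simp add: cone_map_def)
  then show ?thesis using that d_def by blast
qed

subsection \<open>Elements of V as exchanges of dyadic intervals\<close>

text \<open>A combinatorial normal form for V: the source intervals share one level
  \<open>N\<close>, whereas the levels of their images may vary.\<close>

definition cone_exchange :: "(real \<Rightarrow> real) \<Rightarrow> bool" where
  "cone_exchange f \<longleftrightarrow> bij_betw f circ circ \<and> (\<forall>x. x \<notin> circ \<longrightarrow> f x = x) \<and>
     (\<exists>N. \<forall>q. lev N q \<longrightarrow> (\<exists>m p. cone_map f N q m p))"

lemma cone_exchange_bij: "cone_exchange f \<Longrightarrow> bij f"
proof -
  assume f: "cone_exchange f"
  have "bij_betw f (- circ) (- circ)"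
    by (rule bij_betw_cong[THEN iffD1, of _ id]) (use f in \<open>auto simp: cone_exchange_def\<close>)
  then have "bij_betw f (circ \<union> - circ) (circ \<union> - circ)"
    using f by (intro bij_betw_combine) (auto simp: cone_exchange_def)
  then show ?thesis by simp
qed

lemma cone_exchange_outside: "cone_exchange f \<Longrightarrow> x \<notin> circ \<Longrightarrow> f x = x"
  by (simp add: cone_exchange_def)

lemma cone_exchange_circ: "cone_exchange f \<Longrightarrow> f x \<in> circ \<longleftrightarrow> x \<in> circ"
  unfolding cone_exchange_def by (metis bij_betwE)

text \<open>Refining the source by \<open>L\<close> levels makes every target level at least
  \<open>L\<close>. Images can thus be made fine enough for a second map to be affine on them, as
  composition requires.\<close>

lemma cone_exchange_deep:
  assumes "cone_exchange f"
  obtains N where "\<And>n q. N \<le> n \<Longrightarrow> lev n q \<Longrightarrow> \<exists>m\<ge>L. \<exists>p. cone_map f n q m p"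
proof -
  obtain N where N: "\<And>q. lev N q \<Longrightarrow> \<exists>m p. cone_map f N q m p"
    using assms by (auto simp: cone_exchange_def)
  show ?thesis
  proof (rule that[of "N + L"])
    fix n r assume n: "N + L \<le> n" and r: "lev n r"
    obtain q where q: "lev N q" "frac r \<in> dcone N q" using cone_cover by blast
    obtain m p where mp: "cone_map f N q m p" using N q by blast
    obtain s where "cone_map f n r (m + (n - N)) s"
      using cone_map_refine[OF mp r _ q(2)] n by auto
    then show "\<exists>m\<ge>L. \<exists>p. cone_map f n r m p" using n by (intro exI[of _ "m + (n - N)"]) auto
  qed
qed

lemma cone_exchange_id: "cone_exchange id"
proof -
  have "cone_map id 0 q 0 q" if "lev 0 q" for q using that by (simp add: cone_map_def)
  then show ?thesis unfolding cone_exchange_def by (metis bij_betw_id id_apply)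
qed

lemma cone_exchange_compose:
  assumes f: "cone_exchange f" and g: "cone_exchange g"
  shows "cone_exchange (f \<circ> g)"
proof -
  obtain M where M: "\<And>n q. M \<le> n \<Longrightarrow> lev n q \<Longrightarrow> \<exists>m\<ge>0. \<exists>p. cone_map f n q m p"
    using cone_exchange_deep[OF f, of 0] by metis
  obtain N where N: "\<And>n q. N \<le> n \<Longrightarrow> lev n q \<Longrightarrow> \<exists>m\<ge>M. \<exists>p. cone_map g n q m p"
    using cone_exchange_deep[OF g, of M] by metis
  have "\<exists>m p. cone_map (f \<circ> g) N q m p" if q: "lev N q" for q
  proof -
    obtain m p where "m \<ge> M" "cone_map g N q m p" using N[OF order_refl q] by auto
    moreover from this obtain l r where "cone_map f m p l r"
      using M[of m p] by (auto simp: cone_map_def)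
    ultimately show ?thesis using cone_map_compose by blast
  qed
  moreover have "bij_betw (f \<circ> g) circ circ"
    using f g bij_betw_trans unfolding cone_exchange_def by blast
  ultimately show ?thesis using f g unfolding cone_exchange_def by auto
qed

lemma cone_exchange_funpow: "cone_exchange f \<Longrightarrow> cone_exchange (f ^^ n)"
  by (induction n) (auto intro: cone_exchange_id cone_exchange_compose)

lemma cone_map_inverse:
  assumes f: "cone_exchange f" and c: "cone_map f n q m p"
  shows "cone_map (inv_into UNIV f) m p n q"
proof -
  have "inv_into UNIV f (f x) = x" for x
    using cone_exchange_bij[OF f] by (simp add: bij_is_inj)
  then show ?thesis using c unfolding cone_map_def by metis
qed

text \<open>The pieces of the inverse are the images of the finitely many pieces of
  \<open>f\<close>. The largest of their levels is a uniform source level, since an interval of that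
  level lies within a single image.\<close>

lemma cone_exchange_inverse:
  assumes f: "cone_exchange f"
  shows "cone_exchange (inv_into UNIV f)"
proof -
  let ?h = "inv_into UNIV f"
  have bij: "bij f" using cone_exchange_bij[OF f] .
  have hf: "?h (f x) = x" "f (?h x) = x" for x
    using bij by (simp_all add: bij_is_inj bij_is_surj surj_f_inv_f)
  have out: "?h x = x" if "x \<notin> circ" for x
    using hf(1)[of x] cone_exchange_outside[OF f that] by simp
  have hc: "?h x \<in> circ \<longleftrightarrow> x \<in> circ" for x
    using cone_exchange_circ[OF f, of "?h x"] by (simp add: hf)
  have bb: "bij_betw ?h circ circ"
    by (rule bij_betw_byWitness[where f' = f]) (use hf hc cone_exchange_circ[OF f] in auto)
  obtain N where N: "\<And>q. lev N q \<Longrightarrow> \<exists>m p. cone_map f N q m p"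
    using f by (auto simp: cone_exchange_def)
  let ?Q = "{x \<in> circ. lev N x}"
  have "\<forall>q\<in>?Q. \<exists>m. \<exists>p. cone_map f N q m p" using N by auto
  then obtain m where m: "\<And>q. q \<in> ?Q \<Longrightarrow> \<exists>p. cone_map f N q (m q) p" by metis
  define L where "L = Max (insert 0 (m ` ?Q))"
  have L: "m q \<le> L" if "q \<in> ?Q" for q
    unfolding L_def by (rule Max_ge) (use that finite_lev in auto)
  have "\<exists>l s. cone_map ?h L r l s" if r: "lev L r" for r
  proof -
    have "?h (frac r) \<in> circ" using bb by (metis bij_betwE frac_in_circ)
    then have c: "frac (?h (frac r)) = ?h (frac r)" by simp
    obtain q0 where q0: "lev N q0" "?h (frac r) \<in> dcone N q0"
      using cone_cover[of N "?h (frac r)"] c by metis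
    define q where "q = frac q0"
    have q: "q \<in> ?Q" "?h (frac r) \<in> dcone N q"
      using q0 cone_cong[of q q0] by (auto simp: q_def)
    obtain p where p: "cone_map f N q (m q) p" using m q(1) by blast
    have "f (?h (frac r)) \<in> dcone (m q) p" using cone_map_image[OF p] q(2) by blast
    then have "frac r \<in> dcone (m q) p" by (simp add: hf)
    then show ?thesis
      using cone_map_refine[OF cone_map_inverse[OF f p] r L[OF q(1)]] by metis
  qed
  then show ?thesis using bb out unfolding cone_exchange_def by blast
qed

text \<open>\<open>N\<close> does not depend on \<open>x\<close>, and the last equation holds
  between real numbers rather than modulo 1, so neighbourhoods of \<open>x\<close> can be handled on
  the line.\<close>

lemma cone_exchange_point:
  assumes f: "cone_exchange f"
  shows "\<exists>N. \<forall>x. \<exists>q t m p. cone_map f N q m p \<and> 0 \<le> t \<and> t < 1 \<and> x = q - t / 2 ^ N"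
proof -
  obtain N where N: "\<And>q. lev N q \<Longrightarrow> \<exists>m p. cone_map f N q m p"
    using f by (auto simp: cone_exchange_def)
  have "\<exists>q t m p. cone_map f N q m p \<and> 0 \<le> t \<and> t < 1 \<and> x = q - t / 2 ^ N" for x
  proof -
    obtain q where q: "lev N q" "x \<le> q" "q < x + 1 / 2 ^ N" using cone_cover by metis
    obtain m p where mp: "cone_map f N q m p" using N[OF q(1)] by auto
    have "q - x < 1 / 2 ^ N" using q by simp
    then have "0 \<le> 2 ^ N * (q - x)" "2 ^ N * (q - x) < 1" "x = q - 2 ^ N * (q - x) / 2 ^ N"
      using q by (simp_all add: pos_less_divide_eq mult.commute)
    then show ?thesis using mp by blast
  qed
  then show ?thesis by blast
qed

section \<open>Interval exchanges satisfy the analytic description of V\<close>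

lemma cone_exchange_dyadic:
  assumes f: "cone_exchange f" and x: "x \<in> circ" "dyadic x"
  shows "dyadic (f x)"
proof -
  obtain N q t m p where c: "cone_map f N q m p" "0 \<le> t" "t < 1" "x = q - t / 2 ^ N"
    using cone_exchange_point[OF f] by blast
  obtain a where a: "lev a x" using x dyadic_iff_lev by blast
  have "f x = f (frac (q - t / 2 ^ N))" using x c by simp
  then have fx: "f x = frac (p - t / 2 ^ m)" using c by (simp add: cone_map_def)
  have "lev (N + a) (q - x)"
    using a c(1) by (intro lev_diff) (auto simp: cone_map_def intro: lev_mono)
  moreover have "t = 2 ^ N * (q - x)" using c by simp
  ultimately have "2 ^ a * t \<in> \<int>" by (simp add: lev_def power_add mult_ac)
  then have "lev (m + a) (t / 2 ^ m)" by (simp add: lev_def power_add)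
  moreover have "lev (m + a) p" using c(1) lev_mono[of m p "m + a"] by (auto simp: cone_map_def)
  ultimately have "lev (m + a) (f x)" by (simp add: fx lev_diff)
  then show ?thesis using dyadic_iff_lev by blast
qed

lemma cdist_frac_diff:
  assumes "0 \<le> r" "r < 1"
  shows "cdist (frac (u - r)) (frac u) \<le> r"
proof (cases "r \<le> frac u")
  case True
  have "frac (u - r) = frac (frac u - r)" by simp
  also have "\<dots> = frac u - r" using True assms frac_lt_1[of u] by (subst frac_eq) linarith
  finally show ?thesis using assms by (simp add: cdist_def)
next
  case False
  have "frac (u - r) = frac u - r + 1"
  proof -
    have "frac (u - r) = frac (frac u - r + 1)" by (simp add: frac_1_eq)
    also have "\<dots> = frac u - r + 1" using False assms frac_ge_0[of u] by (subst frac_eq) linarith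
    finally show ?thesis .
  qed
  then show ?thesis using assms by (simp add: cdist_def min_def)
qed

lemma cone_exchange_imp_thompsonV:
  assumes f: "cone_exchange f"
  shows "f \<in> thompsonV"
proof -
  obtain N where N: "\<And>x. \<exists>q t m p. cone_map f N q m p \<and> 0 \<le> t \<and> t < 1 \<and> x = q - t / 2 ^ N"
    using cone_exchange_point[OF f] by blast
  have left: "\<exists>d>0. \<forall>t. 0 < t \<and> t < d \<longrightarrow> cdist (f (frac (x - t))) (f x) < e"
    if x: "x \<in> circ" and e: "e > 0" for x e
  proof -
    obtain q t m p where c: "cone_map f N q m p" "0 \<le> t" "t < 1" "x = q - t / 2 ^ N"
      using N by metis
    \<comment> \<open>The three bounds keep \<open>x - s\<close> in the piece of \<open>x\<close>,
      make the displacement of the image smaller than \<open>e\<close>, and make it smaller than 1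
      as \<open>cdist_frac_diff\<close> requires.\<close>
    define d where "d = min ((1 - t) / 2 ^ N) (min (e * 2 ^ m / 2 ^ N) (2 ^ m / 2 ^ N))"
    have "d > 0" using c e by (simp add: d_def)
    moreover have "cdist (f (frac (x - s))) (f x) < e" if s: "0 < s" "s < d" for s
    proof -
      have s': "s < (1 - t) / 2 ^ N" "s < e * 2 ^ m / 2 ^ N" "s < 2 ^ m / 2 ^ N"
        using s by (simp_all add: d_def)
      have "t + 2 ^ N * s < 1" using s'(1) by (simp add: pos_less_divide_eq mult.commute)
      moreover have "x - s = q - (t + 2 ^ N * s) / 2 ^ N" using c(4) by (simp add: field_simps)
      ultimately have "f (frac (x - s)) = frac (p - (t + 2 ^ N * s) / 2 ^ m)"
        using c(2) s(1) by (intro cone_mapD[OF c(1)]) auto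
      also have "p - (t + 2 ^ N * s) / 2 ^ m = (p - t / 2 ^ m) - 2 ^ N * s / 2 ^ m"
        by (simp add: field_simps)
      finally have 1: "f (frac (x - s)) = frac ((p - t / 2 ^ m) - 2 ^ N * s / 2 ^ m)" .
      have "f (frac x) = frac (p - t / 2 ^ m)" using c by (simp add: cone_map_def)
      then have 2: "f x = frac (p - t / 2 ^ m)" using x by simp
      have "2 ^ N * s / 2 ^ m < 1" "2 ^ N * s / 2 ^ m < e"
        using s'(2,3) by (simp_all add: field_simps)
      then show ?thesis
        unfolding 1 2 using cdist_frac_diff[of "2 ^ N * s / 2 ^ m" "p - t / 2 ^ m"] s(1) by simp
    qed
    ultimately show ?thesis by blast
  qed
  \<comment> \<open>Grid points are the right ends of pieces, where the formula may change; every
    other point is interior to its piece.\<close>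
  let ?B = "{x \<in> circ. lev N x}"
  have two: "\<exists>e>0. \<exists>k::int. \<exists>c::real. \<forall>y. \<bar>y - x\<bar> < e \<longrightarrow> f (frac y) = frac (2 powi k * y + c)"
    if x: "x \<in> circ - ?B" for x
  proof -
    obtain q t m p where c: "cone_map f N q m p" "0 \<le> t" "t < 1" "x = q - t / 2 ^ N"
      using N by metis
    have "t \<noteq> 0" using x c by (auto simp: cone_map_def)
    then have t: "0 < t" using c by simp
    have pw: "(2::real) powi (int N - int m) = 2 ^ N / 2 ^ m"
      by (simp add: power_int_diff)
    define e where "e = min t (1 - t) / 2 ^ N"
    have "e > 0" using t c by (simp add: e_def)
    moreover have "f (frac y) = frac (2 powi (int N - int m) * y + (p - 2 ^ N / 2 ^ m * q))"
      if y: "\<bar>y - x\<bar> < e" for y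
    proof -
      have "\<bar>y - x\<bar> < t / 2 ^ N" "\<bar>y - x\<bar> < (1 - t) / 2 ^ N"
        using y by (auto simp: e_def min_def field_simps split: if_splits)
      then have "\<bar>y - x\<bar> * 2 ^ N < t" "\<bar>y - x\<bar> * 2 ^ N < 1 - t"
        by (simp_all add: pos_less_divide_eq)
      moreover have "\<bar>y - x\<bar> * 2 ^ N = \<bar>2 ^ N * (y - x)\<bar>" by (simp add: abs_mult mult.commute)
      ultimately have "\<bar>2 ^ N * (y - x)\<bar> < t" "\<bar>2 ^ N * (y - x)\<bar> < 1 - t" by simp_all
      moreover have tq: "2 ^ N * (q - y) = t - 2 ^ N * (y - x)" using c(4) by (simp add: field_simps)
      ultimately have "0 \<le> 2 ^ N * (q - y)" "2 ^ N * (q - y) < 1" by linarith+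
      moreover have "y = q - (2 ^ N * (q - y)) / 2 ^ N" by simp
      ultimately have "f (frac y) = frac (p - 2 ^ N * (q - y) / 2 ^ m)"
        by (intro cone_mapD[OF c(1)])
      then show ?thesis unfolding pw by (simp add: algebra_simps diff_divide_distrib)
    qed
    ultimately show ?thesis by blast
  qed
  have B: "finite ?B \<and> ?B \<subseteq> circ \<and> (\<forall>b\<in>?B. dyadic b)"
    using finite_lev dyadic_iff_lev by auto
  show ?thesis
    unfolding thompsonV_def mem_Collect_eq
  proof (intro conjI)
    show "bij_betw f circ circ" "\<forall>x. x \<notin> circ \<longrightarrow> f x = x"
      using f unfolding cone_exchange_def by blast+
    show "\<forall>x\<in>circ. dyadic x \<longrightarrow> dyadic (f x)" using cone_exchange_dyadic[OF f] by blast
    show "\<forall>x\<in>circ. \<forall>e>0. \<exists>d>0. \<forall>t. 0 < t \<and> t < d \<longrightarrow> cdist (f (frac (x - t))) (f x) < e"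
      using left by (intro ballI allI impI)
    show "\<exists>B. finite B \<and> B \<subseteq> circ \<and> (\<forall>b\<in>B. dyadic b) \<and>
        (\<forall>x\<in>circ - B. \<exists>e>0. \<exists>k::int. \<exists>c::real.
            \<forall>y. \<bar>y - x\<bar> < e \<longrightarrow> f (frac y) = frac (2 powi k * y + c))"
      using B two by (intro exI[of _ ?B]) simp
  qed
qed

section \<open>Continuing an affine formula along an interval\<close>

lemma frac_affine_unique:
  fixes \<alpha> \<beta> c d b e :: real
  assumes e: "e > 0" and eq: "\<And>y. \<bar>y - b\<bar> < e \<Longrightarrow> frac (\<alpha> * y + c) = frac (\<beta> * y + d)"
  shows "\<alpha> = \<beta> \<and> c - d \<in> \<int>"
proof -
  \<comment> \<open>The difference of the two formulas is affine with integer values near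
    \<open>b\<close>; an increment of absolute value below 1 must therefore vanish.\<close>
  have I: "(\<alpha> - \<beta>) * y + (c - d) \<in> \<int>" if y: "\<bar>y - b\<bar> < e" for y
  proof -
    have "(\<alpha> * y + c) - (\<beta> * y + d) \<in> \<int>" using eq[OF y] by (simp add: frac_eq_frac_iff)
    moreover have "(\<alpha> * y + c) - (\<beta> * y + d) = (\<alpha> - \<beta>) * y + (c - d)" by (simp add: algebra_simps)
    ultimately show ?thesis by simp
  qed
  have "\<alpha> = \<beta>"
  proof (rule ccontr)
    assume "\<alpha> \<noteq> \<beta>"
    define \<delta> where "\<delta> = \<bar>\<alpha> - \<beta>\<bar>"
    have pos: "\<delta> > 0" using \<open>\<alpha> \<noteq> \<beta>\<close> by (simp add: \<delta>_def)
    define s where "s = min (e / 2) (1 / (2 * \<delta>))"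
    have s: "s > 0" "s < e" using e pos by (auto simp: s_def min_def)
    have "s \<le> 1 / (2 * \<delta>)" by (simp add: s_def)
    then have "\<delta> * s \<le> 1 / 2" using pos by (simp add: field_simps)
    then have lt: "\<bar>(\<alpha> - \<beta>) * s\<bar> < 1" using s(1) by (simp add: abs_mult \<delta>_def)
    have "((\<alpha> - \<beta>) * (b + s) + (c - d)) - ((\<alpha> - \<beta>) * b + (c - d)) \<in> \<int>"
      by (rule Ints_diff) (use I[of "b + s"] I[of b] s e in auto)
    then have "(\<alpha> - \<beta>) * s \<in> \<int>" by (simp add: algebra_simps)
    then have "(\<alpha> - \<beta>) * s = 0" using lt by (metis Ints_nonzero_abs_less1)
    then show False using \<open>\<alpha> \<noteq> \<beta>\<close> s by simp
  qed
  then show ?thesis using I[of b] e by simp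
qed

text \<open>Bisection glues the local formulas on compact subintervals, and uniqueness on overlaps
  makes the result independent of the subinterval.\<close>

lemma locally_frac_affine_imp_frac_affine:
  fixes F :: "real \<Rightarrow> real"
  assumes loc: "\<And>x. a < x \<Longrightarrow> x < b \<Longrightarrow>
      \<exists>e>0. \<exists>k::int. \<exists>c::real. \<forall>y. \<bar>y - x\<bar> < e \<longrightarrow> F y = frac (2 powi k * y + c)"
    and ab: "a < b"
  shows "\<exists>(k::int) (c::real). \<forall>y. a < y \<and> y < b \<longrightarrow> F y = frac (2 powi k * y + c)"
proof -
  \<comment> \<open>The margin \<open>e\<close> beyond both ends makes adjacent intervals overlap in
    an open set, so that \<open>frac_affine_unique\<close> applies there.\<close>
  define P where "P u v \<longleftrightarrow> (\<exists>e>0. \<exists>k::int. \<exists>c::real.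
      \<forall>y. u - e < y \<and> y < v + e \<longrightarrow> F y = frac (2 powi k * y + c))" for u v
  have P: "P u v" if uv: "u \<le> v" "a < u" "v < b" for u v
    using uv(1)
  proof (induction rule: Bolzano)
    case (trans u v w)
    obtain e k c where 1: "e > 0" "\<forall>y. u - e < y \<and> y < v + e \<longrightarrow> F y = frac (2 powi (k::int) * y + c)"
      using trans(1) by (auto simp: P_def)
    obtain e' k' c' where 2: "e' > 0" "\<forall>y. v - e' < y \<and> y < w + e' \<longrightarrow> F y = frac (2 powi (k'::int) * y + c')"
      using trans(2) by (auto simp: P_def)
    have "2 powi k = (2 powi k' :: real) \<and> c - c' \<in> \<int>"
    proof (rule frac_affine_unique)
      show "min e e' > 0" using 1 2 by simp
      fix y assume "\<bar>y - v\<bar> < min e e'"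
      then have "u - e < y \<and> y < v + e" "v - e' < y \<and> y < w + e'" using trans(3,4) by auto
      then show "frac (2 powi k * y + c) = frac (2 powi k' * y + c')" using 1 2 by metis
    qed
    then have 3: "frac (2 powi k * y + c) = frac (2 powi k' * y + c')" for y
      by (simp add: frac_eq_frac_iff)
    have "F y = frac (2 powi k * y + c)" if "u - min e e' < y \<and> y < w + min e e'" for y
    proof (cases "y < v + e")
      case True
      then have "u - e < y \<and> y < v + e" using that by auto
      then show ?thesis using 1(2) by blast
    next
      case False
      then have "v - e' < y \<and> y < w + e'" using that 1(1) 2(1) by auto
      then show ?thesis using 2(2) 3 by auto
    qed
    then show ?case using 1(1) 2(1) unfolding P_def
      by (intro exI[of _ "min e e'"] exI[of _ k] exI[of _ c]) auto
  next
    case (local x)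
    obtain e k c where e: "e > 0" "\<forall>y. \<bar>y - x\<bar> < e \<longrightarrow> F y = frac (2 powi (k::int) * y + c)"
      using loc[of x] local uv by auto
    have "P u' v'" if "u' \<le> x \<and> x \<le> v' \<and> v' - u' < e / 2" for u' v'
      unfolding P_def
    proof (intro exI conjI allI impI)
      show "e / 2 > 0" using e by simp
      fix y assume "u' - e / 2 < y \<and> y < v' + e / 2"
      then have "\<bar>y - x\<bar> < e" using that by linarith
      then show "F y = frac (2 powi k * y + c)" using e by blast
    qed
    then show ?case using e(1) by (intro exI[of _ "e / 2"]) auto
  qed
  \<comment> \<open>The formula at the midpoint fixes \<open>k\<close> and \<open>c\<close>; every
    other \<open>y\<close> is joined to it by a compact interval inside the open one.\<close>
  define x0 where "x0 = (a + b) / 2"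
  have x0: "a < x0" "x0 < b" using ab by (auto simp: x0_def)
  obtain e k c where e: "e > 0" "\<forall>y. \<bar>y - x0\<bar> < e \<longrightarrow> F y = frac (2 powi (k::int) * y + c)"
    using loc[OF x0] by auto
  have "F y = frac (2 powi k * y + c)" if y: "a < y" "y < b" for y
  proof -
    have "P (min x0 y) (max x0 y)" using x0 y by (intro P) auto
    then obtain e' k' c' where 2: "e' > 0"
      "\<And>z. min x0 y - e' < z \<and> z < max x0 y + e' \<Longrightarrow> F z = frac (2 powi (k'::int) * z + c')"
      by (auto simp: P_def)
    have "2 powi k = (2 powi k' :: real) \<and> c - c' \<in> \<int>"
    proof (rule frac_affine_unique)
      show "min e e' > 0" using e 2 by simp
      fix z assume z: "\<bar>z - x0\<bar> < min e e'"
      then have "\<bar>z - x0\<bar> < e'" by simp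
      then have "min x0 y - e' < z \<and> z < max x0 y + e'" by linarith
      then show "frac (2 powi k * z + c) = frac (2 powi k' * z + c')" using 2 e z by auto
    qed
    then have 3: "frac (2 powi k * y + c) = frac (2 powi k' * y + c')"
      by (simp add: frac_eq_frac_iff)
    have "min x0 y - e' < y \<and> y < max x0 y + e'" using 2(1) by linarith
    then show ?thesis using 2(2)[of y] 3 by simp
  qed
  then show ?thesis by blast
qed

section \<open>Circular distance and left limits\<close>

lemma cdist_eq_0: "x \<in> circ \<Longrightarrow> y \<in> circ \<Longrightarrow> cdist x y \<le> 0 \<Longrightarrow> x = y"
  by (auto simp: cdist_def circ_def min_def split: if_splits)

lemma cdist_triangle:
  assumes "x \<in> circ" "y \<in> circ" "z \<in> circ"
  shows "cdist x z \<le> cdist x y + cdist y z"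
proof -
  have "\<bar>x - z\<bar> \<le> \<bar>x - y\<bar> + \<bar>y - z\<bar>" "\<bar>y - z\<bar> \<le> \<bar>x - y\<bar> + \<bar>x - z\<bar>" "\<bar>x - y\<bar> \<le> \<bar>y - z\<bar> + \<bar>x - z\<bar>"
    by linarith+
  moreover have "\<bar>x - z\<bar> + \<bar>x - y\<bar> + \<bar>y - z\<bar> \<le> 2" using assms unfolding circ_def by (auto simp: abs_if)
  ultimately show ?thesis unfolding cdist_def min_def by (simp split: if_split)
qed

lemma cdist_sym: "cdist x y = cdist y x"
  by (simp add: cdist_def abs_minus_commute)

lemma left_limit_frac:
  assumes w: "w \<in> circ" and \<alpha>: "\<alpha> > 0"
    and lim: "\<And>e. e > 0 \<Longrightarrow> \<exists>d>0. \<forall>t. 0 < t \<and> t < d \<longrightarrow> cdist (frac (P - \<alpha> * t)) w < e"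
  shows "w = frac P"
proof -
  have "cdist (frac P) w \<le> 0"
  proof (rule field_le_epsilon)
    fix e :: real assume e: "e > 0"
    obtain d where d: "d > 0" "\<forall>t. 0 < t \<and> t < d \<longrightarrow> cdist (frac (P - \<alpha> * t)) w < e / 2"
      using lim[of "e / 2"] e by auto
    define t where "t = min (d / 2) (min (1 / 2) (e / 2) / \<alpha>)"
    have t: "0 < t" "t < d" using d e \<alpha> by (auto simp: t_def min_def)
    have "t \<le> min (1 / 2) (e / 2) / \<alpha>" by (simp add: t_def)
    then have "\<alpha> * t \<le> min (1 / 2) (e / 2)" using \<alpha> by (simp add: pos_le_divide_eq mult.commute)
    then have t2: "0 \<le> \<alpha> * t" "\<alpha> * t < 1" "\<alpha> * t \<le> e / 2" using \<alpha> t by auto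
    have "cdist (frac P) w \<le> cdist (frac P) (frac (P - \<alpha> * t)) + cdist (frac (P - \<alpha> * t)) w"
      using w by (intro cdist_triangle) auto
    also have "\<dots> \<le> e / 2 + e / 2"
      using cdist_frac_diff[OF t2(1,2), of P] t2(3) d t by (intro add_mono) (auto simp: cdist_sym)
    finally show "cdist (frac P) w \<le> 0 + e" by simp
  qed
  then show ?thesis using cdist_eq_0[of "frac P" w] w by simp
qed

section \<open>Elements of V are interval exchanges\<close>

lemma finite_dyadic_lev:
  assumes "finite B" "\<forall>b\<in>B. dyadic b"
  obtains N where "\<And>b. b \<in> B \<Longrightarrow> lev N b"
proof -
  have "\<forall>b\<in>B. \<exists>n. lev n b" using assms dyadic_iff_lev by blast
  then obtain n where n: "\<And>b. b \<in> B \<Longrightarrow> lev (n b) b" by metis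
  show ?thesis
  proof (rule that)
    fix b assume b: "b \<in> B"
    show "lev (Max (insert 0 (n ` B))) b"
      by (rule lev_mono[OF n[OF b]], rule Max_ge) (use assms b in auto)
  qed
qed

text \<open>Once every exceptional point is a grid point, each open gap between neighbouring grid
  points carries a single affine formula, and left-continuity extends it to the right end of the
  gap.\<close>

lemma thompsonV_affine_pieces:
  assumes f: "f \<in> thompsonV"
  obtains N where "\<And>q. lev N q \<Longrightarrow> \<exists>k::int. \<forall>t. 0 \<le> t \<and> t < 1 / 2 ^ N \<longrightarrow>
      f (frac (q - t)) = frac (f (frac q) - 2 powi k * t)"
proof -
  note fV = f[unfolded thompsonV_def mem_Collect_eq]
  obtain B where B': "finite B \<and> B \<subseteq> circ \<and> (\<forall>b\<in>B. dyadic b) \<and>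
        (\<forall>x\<in>circ - B. \<exists>e>0. \<exists>k::int. \<exists>c::real.
            \<forall>y. \<bar>y - x\<bar> < e \<longrightarrow> f (frac y) = frac (2 powi k * y + c))"
    using fV by (elim conjE exE) simp
  have B: "finite B" "\<forall>b\<in>B. dyadic b" using B' by simp_all
  have two: "\<exists>e>0. \<exists>k::int. \<exists>c::real. \<forall>y. \<bar>y - x\<bar> < e \<longrightarrow> f (frac y) = frac (2 powi k * y + c)"
    if "x \<in> circ - B" for x using B' that by simp
  have left: "\<exists>d>0. \<forall>t. 0 < t \<and> t < d \<longrightarrow> cdist (f (frac (x - t))) (f x) < e"
    if "x \<in> circ" "e > 0" for x e using fV that by simp
  have bij: "bij_betw f circ circ" using fV by simp
  obtain N where N: "\<And>b. b \<in> B \<Longrightarrow> lev N b" using finite_dyadic_lev[OF B] by metis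
  show ?thesis
  proof (rule that[of N])
    fix q assume q: "lev N q"
    define a where "a = q - 1 / 2 ^ N"
    have aq: "a < q" by (simp add: a_def)
    have "\<exists>(k::int) (c::real). \<forall>y. a < y \<and> y < q \<longrightarrow> f (frac y) = frac (2 powi k * y + c)"
    proof (rule locally_frac_affine_imp_frac_affine[OF _ aq])
      fix x assume x: "a < x" "x < q"
      have "\<not> lev N x"
      proof
        assume l: "lev N x"
        have "q \<le> x" by (rule lev_less_imp[OF q l]) (use x in \<open>simp add: a_def\<close>)
        then show False using x by simp
      qed
      then have "frac x \<notin> B" using N lev_frac by blast
      then obtain e k c where e: "e > 0"
        "\<And>y. \<bar>y - frac x\<bar> < e \<Longrightarrow> f (frac y) = frac (2 powi (k::int) * y + c)"
        using two[of "frac x"] by auto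
      \<comment> \<open>The formula around \<open>frac x\<close> is carried to \<open>x\<close> by
        an integer shift, which changes only the constant.\<close>
      have "f (frac y) = frac (2 powi k * y + (c - 2 powi k * of_int \<lfloor>x\<rfloor>))" if y: "\<bar>y - x\<bar> < e" for y
      proof -
        have "\<bar>(y - of_int \<lfloor>x\<rfloor>) - frac x\<bar> < e" using y by (simp add: frac_def)
        from e(2)[OF this] have "f (frac (y - of_int \<lfloor>x\<rfloor>)) = frac (2 powi k * (y - of_int \<lfloor>x\<rfloor>) + c)" .
        moreover have "frac (y - of_int \<lfloor>x\<rfloor>) = frac y" by (simp add: frac_eq_frac_iff)
        ultimately show ?thesis by (simp add: algebra_simps)
      qed
      then show "\<exists>e>0. \<exists>k::int. \<exists>c::real. \<forall>y. \<bar>y - x\<bar> < e \<longrightarrow> f (frac y) = frac (2 powi k * y + c)"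
        using e(1) by blast
    qed
    then obtain k :: int and c :: real where
      kc: "\<And>y. a < y \<Longrightarrow> y < q \<Longrightarrow> f (frac y) = frac (2 powi k * y + c)" by blast
    define P where "P = 2 powi k * q + c"
    have kc': "f (frac (q - t)) = frac (P - 2 powi k * t)" if "0 < t" "t < 1 / 2 ^ N" for t
    proof -
      have "f (frac (q - t)) = frac (2 powi k * (q - t) + c)" by (rule kc) (use that in \<open>auto simp: a_def\<close>)
      then show ?thesis by (simp add: P_def algebra_simps)
    qed
    have fq: "f (frac q) = frac P"
    proof (rule left_limit_frac[where \<alpha> = "2 powi k"])
      show "f (frac q) \<in> circ" using bij by (metis bij_betwE frac_in_circ)
      fix e :: real assume "e > 0"
      then obtain d where d: "d > 0" "\<And>t. 0 < t \<and> t < d \<Longrightarrow> cdist (f (frac (frac q - t))) (f (frac q)) < e"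
        using left[of "frac q" e] by auto
      have "cdist (frac (P - 2 powi k * t)) (f (frac q)) < e"
        if t: "0 < t" "t < min d (1 / 2 ^ N)" for t
        using d(2)[of t] kc'[of t] t by auto
      then show "\<exists>d>0. \<forall>t. 0 < t \<and> t < d \<longrightarrow> cdist (frac (P - 2 powi k * t)) (f (frac q)) < e"
        using d(1) by (intro exI[of _ "min d (1 / 2 ^ N)"]) auto
    qed simp
    have "f (frac (q - t)) = frac (f (frac q) - 2 powi k * t)" if "0 \<le> t \<and> t < 1 / 2 ^ N" for t
      using that kc'[of t] fq by (cases "t = 0") auto
    then show "\<exists>k::int. \<forall>t. 0 \<le> t \<and> t < 1 / 2 ^ N \<longrightarrow>
      f (frac (q - t)) = frac (f (frac q) - 2 powi k * t)" by blast
  qed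
qed

text \<open>An affine piece need not map onto a dyadic interval, for instance when its slope is
  large. After enough subdivision the target level is a natural number and the target endpoint lies
  on its grid; finitely many pieces admit a common depth.\<close>

lemma thompsonV_imp_cone_exchange:
  assumes f: "f \<in> thompsonV"
  shows "cone_exchange f"
proof -
  have bij: "bij_betw f circ circ" and out: "\<forall>x. x \<notin> circ \<longrightarrow> f x = x"
    and dy: "\<And>x. x \<in> circ \<Longrightarrow> dyadic x \<Longrightarrow> dyadic (f x)"
    using f by (simp_all add: thompsonV_def)
  obtain N where N: "\<And>q. lev N q \<Longrightarrow> \<exists>k::int. \<forall>t. 0 \<le> t \<and> t < 1 / 2 ^ N \<longrightarrow>
      f (frac (q - t)) = frac (f (frac q) - 2 powi k * t)"
    using thompsonV_affine_pieces[OF f] by metis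
  let ?Q = "{x \<in> circ. lev N x}"
  have "\<exists>D. \<forall>n\<ge>D. \<forall>r. lev n r \<longrightarrow> frac r \<in> dcone N q \<longrightarrow> (\<exists>m p. cone_map f n r m p)"
    if q: "q \<in> ?Q" for q
  proof -
    obtain k :: int where k: "\<And>t. 0 \<le> t \<Longrightarrow> t < 1 / 2 ^ N \<Longrightarrow> f (frac (q - t)) = frac (f q - 2 powi k * t)"
      using N[of q] q by auto
    have "dyadic (f q)" using q dy dyadic_iff_lev by auto
    then obtain b where b: "lev b (f q)" using dyadic_iff_lev by blast
    \<comment> \<open>This ensures \<open>n >= N\<close> and \<open>n - k >= b\<close>, so that
      \<open>m\<close> is not truncated at 0 and \<open>f q\<close> has level
      \<open>m\<close>.\<close>
    define D where "D = N + nat \<bar>k\<bar> + b"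
    have "\<exists>m p. cone_map f n r m p" if n: "D \<le> n" and r: "lev n r" "frac r \<in> dcone N q" for n r
    proof -
      define m where "m = nat (int n - k)"
      have m: "int m = int n - k" "b \<le> m" using n by (auto simp: m_def D_def)
      have "n \<ge> N" using n by (simp add: D_def)
      obtain z where z: "z \<in> \<int>" "0 \<le> q - r + z" "q - r + z < 1 / 2 ^ N"
        using r mem_cone_iff by metis
      define t0 where "t0 = q - r + z"
      have t0: "0 \<le> t0" "t0 < 1 / 2 ^ N" using z by (auto simp: t0_def)
      have levt0: "lev n t0" unfolding t0_def
        using q z(1) r(1) \<open>n \<ge> N\<close> lev_mono[of N q n] lev_Ints[of z n] by (intro lev_add lev_diff) auto
      have t0n: "t0 \<le> 1 / 2 ^ N - 1 / 2 ^ n"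
        by (rule lev_less_imp[OF levt0])
          (use t0 lev_mono[OF lev_inv_power \<open>n \<ge> N\<close>] lev_inv_power in \<open>auto intro: lev_diff\<close>)
      have pw: "2 powi k = (2 ^ n / 2 ^ m :: real)"
      proof -
        have "k = int n - int m" using m by simp
        then show ?thesis by (simp add: power_int_diff)
      qed
      define p where "p = f q - 2 powi k * t0"
      have "2 ^ n * t0 \<in> \<int>" using levt0 by (simp add: lev_def)
      then have "lev m (2 powi k * t0)" by (simp add: lev_def pw)
      then have levp: "lev m p" using b m lev_mono[OF b] by (auto simp: p_def intro: lev_diff)
      have "f (frac (r - t / 2 ^ n)) = frac (p - t / 2 ^ m)" if t: "0 \<le> t" "t < 1" for t
      proof -
        have "r - t / 2 ^ n - (q - (t0 + t / 2 ^ n)) = z" by (simp add: t0_def)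
        then have "frac (r - t / 2 ^ n) = frac (q - (t0 + t / 2 ^ n))"
          using z(1) frac_eq_frac_iff by metis
        moreover have "t / 2 ^ n < 1 / 2 ^ n" using t by (simp add: divide_strict_right_mono)
        then have "t0 + t / 2 ^ n < 1 / 2 ^ N" using t0n by simp
        ultimately have "f (frac (r - t / 2 ^ n)) = frac (f q - 2 powi k * (t0 + t / 2 ^ n))"
          using k[of "t0 + t / 2 ^ n"] t t0 by simp
        then show ?thesis by (simp add: p_def pw algebra_simps add_divide_distrib)
      qed
      then show ?thesis using r(1) levp unfolding cone_map_def by blast
    qed
    then show ?thesis by blast
  qed
  then have "\<forall>q\<in>?Q. \<exists>D. \<forall>n\<ge>D. \<forall>r. lev n r \<longrightarrow> frac r \<in> dcone N q \<longrightarrow> (\<exists>m p. cone_map f n r m p)"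
    by blast
  then obtain D where D: "\<And>q n r. q \<in> ?Q \<Longrightarrow> D q \<le> n \<Longrightarrow> lev n r \<Longrightarrow> frac r \<in> dcone N q \<Longrightarrow>
      \<exists>m p. cone_map f n r m p"
    by metis
  define L where "L = Max (insert 0 (D ` ?Q))"
  have L: "D q \<le> L" if "q \<in> ?Q" for q
    unfolding L_def by (rule Max_ge) (use that finite_lev in auto)
  have "\<exists>m p. cone_map f L r m p" if r: "lev L r" for r
  proof -
    obtain q where q: "lev N q" "frac r \<in> dcone N q" using cone_cover by metis
    then have "frac q \<in> ?Q" "frac r \<in> dcone N (frac q)" using cone_cong[of q "frac q"] by auto
    then show ?thesis using D[OF _ L r] by blast
  qed
  then show ?thesis using bij out unfolding cone_exchange_def by blast
qed

lemma thompsonV_iff: "f \<in> thompsonV \<longleftrightarrow> cone_exchange f"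
  using thompsonV_imp_cone_exchange cone_exchange_imp_thompsonV by blast

subsection \<open>Thin dyadic intervals\<close>

text \<open>Every forward orbit, hence by injectivity every full orbit, meets a thin set at most once.\<close>

definition thin :: "('a \<Rightarrow> 'a) \<Rightarrow> 'a set \<Rightarrow> bool" where
  "thin f I \<longleftrightarrow> (\<forall>x\<in>I. \<forall>n. (f ^^ n) x \<in> I \<longrightarrow> (f ^^ n) x = x)"

lemma funpow_inv_into:
  assumes "bij f"
  shows "(f ^^ n) ((inv_into UNIV f ^^ n) x) = x" "(inv_into UNIV f ^^ n) ((f ^^ n) x) = x"
proof -
  have hf: "inv_into UNIV f (f x) = x" "f (inv_into UNIV f x) = x" for x
    using assms by (simp_all add: bij_is_inj bij_is_surj surj_f_inv_f)
  show "(f ^^ n) ((inv_into UNIV f ^^ n) x) = x"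
    by (induction n arbitrary: x) (simp_all add: hf funpow_swap1)
  show "(inv_into UNIV f ^^ n) ((f ^^ n) x) = x"
    by (induction n arbitrary: x) (simp_all add: hf funpow_swap1)
qed

text \<open>A return of \<open>f\<close> read backwards is a return of the inverse that starts from
  the later point.\<close>

lemma thin_inverse:
  assumes "bij f" "thin (inv_into UNIV f) I"
  shows "thin f I"
  unfolding thin_def
proof (intro ballI allI impI)
  fix x n assume "x \<in> I" "(f ^^ n) x \<in> I"
  moreover have "(inv_into UNIV f ^^ n) ((f ^^ n) x) = x" using funpow_inv_into[OF assms(1)] by blast
  ultimately show "(f ^^ n) x = x" using assms(2) unfolding thin_def by metis
qed

text \<open>Points of \<open>J\<close> come back to \<open>J\<close> only at multiples of
  \<open>m\<close>, and at positive multiples they land in the image of \<open>J\<close> under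
  \<open>f ^^ m\<close>, which \<open>I\<close> avoids.\<close>

lemma thin_first_return:
  assumes m: "m > 0" and dis: "\<And>i. 0 < i \<Longrightarrow> i < m \<Longrightarrow> (f ^^ i) ` J \<inter> J = {}"
    and ret: "(f ^^ m) ` J \<subseteq> J" and IJ: "I \<subseteq> J" and new: "I \<inter> (f ^^ m) ` J = {}"
  shows "thin f I"
  unfolding thin_def
proof (intro ballI allI impI)
  fix x n assume x: "x \<in> I" "(f ^^ n) x \<in> I"
  have stay: "(f ^^ (m * k)) y \<in> J" if "y \<in> J" for k y
  proof (induction k)
    case (Suc k)
    have "(f ^^ (m * Suc k)) y = (f ^^ m) ((f ^^ (m * k)) y)" by (simp add: funpow_add)
    then show ?case using Suc ret by auto
  qed (use that in simp)
  define k r where "k = n div m" and "r = n mod m"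
  have n: "n = r + m * k" by (simp add: k_def r_def)
  have "r < m" using m by (simp add: r_def)
  have fx: "(f ^^ n) x = (f ^^ r) ((f ^^ (m * k)) x)" by (simp add: n funpow_add)
  have "r = 0"
  proof (rule ccontr)
    assume "r \<noteq> 0"
    then have "(f ^^ r) ` J \<inter> J = {}" using dis \<open>r < m\<close> by auto
    then show False using fx x IJ stay by (metis IntI empty_iff imageI subsetD)
  qed
  show "(f ^^ n) x = x"
  proof (cases k)
    case 0
    then show ?thesis using n \<open>r = 0\<close> by simp
  next
    case (Suc k')
    then have "(f ^^ n) x = (f ^^ m) ((f ^^ (m * k')) x)" using n \<open>r = 0\<close> by (simp add: funpow_add)
    then have "(f ^^ n) x \<in> (f ^^ m) ` J" using stay[of x k'] x IJ by auto
    then show ?thesis using x new by auto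
  qed
qed

text \<open>From some moment on the orbit avoids the points of the level on which \<open>f\<close> is affine. A cone
  ending at such an orbit point is therefore mapped to a cone by all iterates; take one of
  minimal level.\<close>

lemma thin_cone_infinite_orbit:
  assumes f: "cone_exchange f" and q: "q \<in> circ" "dyadic q"
    and inf: "\<And>n. n > 0 \<Longrightarrow> (f ^^ n) q \<noteq> q"
  shows "\<exists>n r. lev n r \<and> thin f (dcone n r)"
proof -
  have inj: "inj (f ^^ n)" for n using cone_exchange_bij[OF cone_exchange_funpow[OF f]] bij_is_inj by blast
  have circ: "(f ^^ n) x \<in> circ \<longleftrightarrow> x \<in> circ" for n x
    using cone_exchange_circ[OF cone_exchange_funpow[OF f]] by blast
  have neq: "(f ^^ j) q \<noteq> (f ^^ i) q" if "i < j" for i j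
  proof
    assume "(f ^^ j) q = (f ^^ i) q"
    moreover have "(f ^^ j) q = (f ^^ i) ((f ^^ (j - i)) q)"
      using that funpow_add[of i "j - i" f] by (simp add: fun_eq_iff)
    ultimately have "(f ^^ (j - i)) q = q" using inj injD by metis
    then show False using inf[of "j - i"] that by simp
  qed
  then have injq: "inj (\<lambda>j. (f ^^ j) q)" by (intro linorder_injI) metis
  obtain N where N: "\<And>n q. N \<le> n \<Longrightarrow> lev n q \<Longrightarrow> \<exists>m\<ge>0. \<exists>p. cone_map f n q m p"
    using cone_exchange_deep[OF f, of 0] by metis
  \<comment> \<open>The orbit never repeats a point, so it leaves the finitely many grid points of
    level \<open>N\<close> for good.\<close>
  have "finite {j. (f ^^ j) q \<in> {x \<in> circ. lev N x}}"
    using finite_vimageI[OF finite_lev injq] by (simp add: vimage_def)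
  then obtain J where J: "\<And>j. J \<le> j \<Longrightarrow> \<not> lev N ((f ^^ j) q)"
    using circ q(1) by (auto simp: finite_nat_set_iff_bounded) (metis linorder_not_le)
  define q' where "q' = (f ^^ J) q"
  have q': "q' \<in> circ" "dyadic q'"
    using q circ cone_exchange_dyadic[OF cone_exchange_funpow[OF f]] by (auto simp: q'_def)
  have J': "\<not> lev N ((f ^^ j) q')" for j
  proof -
    have "(f ^^ j) q' = (f ^^ (j + J)) q" by (simp add: q'_def funpow_add)
    then show ?thesis using J[of "j + J"] by simp
  qed
  have inf': "(f ^^ n) ((f ^^ j) q') \<noteq> (f ^^ j) q'" if "n > 0" for n j
  proof -
    have "(f ^^ n) ((f ^^ j) q') = (f ^^ (n + j + J)) q" "(f ^^ j) q' = (f ^^ (j + J)) q"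
      by (simp_all add: q'_def funpow_add)
    then show ?thesis using neq[of "j + J" "n + j + J"] that by simp
  qed
  obtain a0 where a0: "lev a0 q'" using q' dyadic_iff_lev by blast
  have track: "\<exists>a p. cone_map (f ^^ j) a0 q' a p" for j
  proof (induction j)
    case 0
    show ?case using a0 by (auto simp: cone_map_def)
  next
    case (Suc j)
    then obtain a p where ap: "cone_map (f ^^ j) a0 q' a p" by blast
    \<comment> \<open>With \<open>a < N\<close> the orbit point would be a grid point of level
      \<open>N\<close>; hence the current interval is fine enough for \<open>f\<close> to be affine
      on it.\<close>
    have "(f ^^ j) q' = frac p" using cone_map_app[OF ap] q' by simp
    then have "\<not> lev N p" using J'[of j] by simp
    then have "N \<le> a" using ap lev_mono[of a p N] by (force simp: cone_map_def)
    then obtain m p' where "cone_map f a p m p'" using N[of a p] ap by (auto simp: cone_map_def)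
    then have "cone_map (f ^^ Suc j) a0 q' m p'" using cone_map_compose[OF ap] by simp
    then show ?case by blast
  qed
  define reached where "reached a \<longleftrightarrow> (\<exists>j p. cone_map (f ^^ j) a0 q' a p)" for a
  define a where "a = (LEAST a. reached a)"
  have "\<exists>a. reached a" using track[of 0] unfolding reached_def by blast
  then have "reached a" unfolding a_def by (rule LeastI_ex)
  then obtain j p where jp: "cone_map (f ^^ j) a0 q' a p" unfolding reached_def by blast
  have p: "lev a p" "(f ^^ j) q' = frac p"
    using jp cone_map_app[OF jp] q' by (auto simp: cone_map_def)
  \<comment> \<open>By minimality of \<open>a\<close> no later image is larger than this interval,
    so an image that meets it is nested inside it.\<close>
  have images: "\<exists>b\<ge>a. \<exists>s. cone_map (f ^^ i) a p b s" for i
  proof -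
    obtain b s where bs: "cone_map (f ^^ (i + j)) a0 q' b s" using track by blast
    then have "reached b" unfolding reached_def by blast
    then have "a \<le> b" unfolding a_def by (rule Least_le)
    moreover have "cone_map (f ^^ i) a p b s"
      using jp bs unfolding cone_map_def by (metis comp_apply funpow_add)
    ultimately show ?thesis by blast
  qed
  let ?I = "dcone a p"
  show ?thesis
  proof (cases "\<exists>i>0. (f ^^ i) ` ?I \<inter> ?I \<noteq> {}")
    case False
    have "thin f ?I"
      unfolding thin_def
    proof (intro ballI allI impI)
      fix x n assume "x \<in> ?I" "(f ^^ n) x \<in> ?I"
      then have "n = 0" using False by auto
      then show "(f ^^ n) x = x" by simp
    qed
    then show ?thesis using p by blast
  next
    case True
    define m where "m = (LEAST i. 0 < i \<and> (f ^^ i) ` ?I \<inter> ?I \<noteq> {})"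
    have m: "0 < m" "(f ^^ m) ` ?I \<inter> ?I \<noteq> {}"
      using True LeastI_ex[of "\<lambda>i. 0 < i \<and> (f ^^ i) ` ?I \<inter> ?I \<noteq> {}"] by (simp_all add: m_def)
    obtain b s where bs: "b \<ge> a" "cone_map (f ^^ m) a p b s" using images by blast
    have im: "(f ^^ m) ` ?I = dcone b s" using cone_map_image[OF bs(2)] .
    have levs: "lev b s" "lev b p" using bs p lev_mono[of a p b] by (auto simp: cone_map_def)
    have "frac s \<noteq> frac p" using inf'[OF m(1), of j] cone_map_app[OF bs(2)] p by simp
    \<comment> \<open>The first returning image has level \<open>b\<close> and ends at a point other
      than \<open>p\<close>, so it is disjoint from the interval of the same level that ends at
      \<open>p\<close>.\<close>
    have "thin f (dcone b p)"
    proof (rule thin_first_return)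
      show "0 < m" by (fact m)
      show "(f ^^ i) ` ?I \<inter> ?I = {}" if "0 < i" "i < m" for i
        using that not_less_Least[of i "\<lambda>i. 0 < i \<and> (f ^^ i) ` ?I \<inter> ?I \<noteq> {}"] by (simp add: m_def)
      show "(f ^^ m) ` ?I \<subseteq> ?I"
        using cone_nested[OF p(1) levs(1) bs(1)] m(2) im by simp
      show "dcone b p \<subseteq> ?I" using cone_antimono p bs by simp
      show "dcone b p \<inter> (f ^^ m) ` ?I = {}"
        unfolding im using levs \<open>frac s \<noteq> frac p\<close> by (intro cone_disjoint) auto
    qed
    then show ?thesis using levs by blast
  qed
qed

text \<open>Near \<open>q\<close>, on the left, the return map has slope at most 1. On a small
  interval ending at \<open>q\<close> it is either the identity or a contraction into a smaller
  interval ending at \<open>q\<close>, which leaves half of the interval free of returns.\<close>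

lemma thin_cone_nonexpanding_periodic:
  assumes f: "cone_exchange f" and q: "q \<in> circ" and m: "m > 0"
    and least: "\<And>i. 0 < i \<Longrightarrow> i < m \<Longrightarrow> (f ^^ i) q \<noteq> q"
    and c: "cone_map (f ^^ m) n q a q" and na: "n \<le> a"
  shows "\<exists>n r. lev n r \<and> thin f (dcone n r)"
proof -
  have dq: "dyadic q" using c dyadic_iff_lev by (auto simp: cone_map_def)
  \<comment> \<open>At a level common to the whole orbit of \<open>q\<close>, distinct orbit points
    are the ends of disjoint intervals.\<close>
  obtain L where L: "\<And>b. b \<in> (\<lambda>i. (f ^^ i) q) ` {..m} \<Longrightarrow> lev L b"
    using finite_dyadic_lev[of "(\<lambda>i. (f ^^ i) q) ` {..m}"]
      cone_exchange_dyadic[OF cone_exchange_funpow[OF f] q dq] by auto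
  have "\<forall>i. \<exists>N. \<forall>k\<ge>N. \<forall>r. lev k r \<longrightarrow> (\<exists>b\<ge>L. \<exists>p. cone_map (f ^^ i) k r b p)"
    using cone_exchange_deep[OF cone_exchange_funpow[OF f], of L] by metis
  then obtain N where N: "\<And>i k r. N i \<le> k \<Longrightarrow> lev k r \<Longrightarrow> \<exists>b\<ge>L. \<exists>p. cone_map (f ^^ i) k r b p"
    by metis
  \<comment> \<open>Fine enough for the images of \<open>dcone l q\<close> under all iterates up to
    \<open>m\<close> to have level at least \<open>L\<close>, and for \<open>c\<close> to be
    restricted to it.\<close>
  define l where "l = Max (insert (n + L) (N ` {..m}))"
  have l: "n + L \<le> l" "\<And>i. i \<le> m \<Longrightarrow> N i \<le> l" unfolding l_def by (rule Max_ge; simp)+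
  have lq: "lev L q" using L[of q] image_eqI[of q "\<lambda>i. (f ^^ i) q" 0] by auto
  have levq: "lev l q" using lq lev_mono[of L q l] l by auto
  let ?J = "dcone l q"
  have dis: "(f ^^ i) ` ?J \<inter> ?J = {}" if i: "0 < i" "i < m" for i
  proof -
    obtain b p where bp: "b \<ge> L" "cone_map (f ^^ i) l q b p" using N[of i l q] l(2)[of i] i levq by auto
    have fp: "frac p = (f ^^ i) q" using cone_map_app[OF bp(2)] q by simp
    have "lev L (frac p)" unfolding fp by (rule L) (use i in auto)
    then have lp: "lev L p" by simp
    have "frac p \<noteq> frac q" using fp least[OF i] q by simp
    then have "dcone L p \<inter> dcone L q = {}" by (rule cone_disjoint[OF lp lq])
    moreover have "dcone b p \<subseteq> dcone L p" using cone_antimono lp bp by simp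
    moreover have "?J \<subseteq> dcone L q" using cone_antimono lq l by simp
    ultimately show ?thesis unfolding cone_map_image[OF bp(2)] by blast
  qed
  obtain s where s: "cone_map (f ^^ m) l q (a + (l - n)) s"
    using cone_map_refine[OF c levq _ mem_cone_self] l by auto
  define b where "b = a + (l - n)"
  have "frac s = frac q" using cone_map_app[OF s] cone_map_app[OF c] by simp
  then have cb: "cone_map (f ^^ m) l q b q"
    using s cone_map_cong[of q q s q] unfolding b_def by blast
  have lb: "l \<le> b" using na l by (simp add: b_def)
  have im: "(f ^^ m) ` ?J = dcone b q" using cone_map_image[OF cb] .
  show ?thesis
  proof (cases "l = b")
    case True
    have id: "(f ^^ m) x = x" if "x \<in> ?J" for x
      using that cb True by (auto simp: dcone_def cone_map_def)
    have "thin f ?J"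
      unfolding thin_def
    proof (intro ballI allI impI)
      fix x k assume x: "x \<in> ?J" "(f ^^ k) x \<in> ?J"
      \<comment> \<open>Since \<open>f ^^ m\<close> fixes \<open>?J\<close> pointwise, return times
        may be reduced modulo \<open>m\<close>, and \<open>dis\<close> excludes a nonzero
        remainder.\<close>
      have "(f ^^ (k mod m)) x = (f ^^ k) x" using id[OF x(1)] by (simp add: funpow_mod_eq)
      then have "k mod m = 0" using dis[of "k mod m"] x m by (cases "k mod m = 0") auto
      then show "(f ^^ k) x = x" using \<open>(f ^^ (k mod m)) x = (f ^^ k) x\<close> by simp
    qed
    then show ?thesis using levq by blast
  next
    case False
    then have lb: "Suc l \<le> b" using lb by simp
    \<comment> \<open>The right end of the left half of \<open>?J\<close>; the contracted image lies
      in the right half because \<open>Suc l <= b\<close>.\<close>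
    define r where "r = q - 1 / 2 ^ Suc l"
    have lev: "lev (Suc l) r" "lev (Suc l) q" "lev l q"
      using levq lev_mono[of l q "Suc l"] lev_inv_power[of "Suc l"] by (auto simp: r_def intro: lev_diff)
    have "r - q \<notin> \<int>"
    proof -
      have "r - q = - (1 / 2 ^ Suc l)" by (simp add: r_def)
      moreover have "\<bar>- (1 / 2 ^ Suc l) :: real\<bar> < 1" by (simp add: power_less_one_iff one_less_power del: power_Suc)
      ultimately show ?thesis using Ints_nonzero_abs_less1[of "r - q"] by auto
    qed
    then have ne: "frac r \<noteq> frac q" by (simp add: frac_eq_frac_iff)
    have "thin f (dcone (Suc l) r)"
    proof (rule thin_first_return)
      show "0 < m" by (fact m)
      show "(f ^^ i) ` ?J \<inter> ?J = {}" if "0 < i" "i < m" for i by (rule dis[OF that])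
      show "(f ^^ m) ` ?J \<subseteq> ?J" unfolding im using cone_antimono[OF levq] lb by simp
      show "dcone (Suc l) r \<inter> (f ^^ m) ` ?J = {}"
        unfolding im using cone_disjoint[OF lev(1,2) ne] cone_antimono[OF lev(2) lb] by blast
      have "frac r \<in> ?J"
        unfolding mem_cone_iff by (rule bexI[of _ 0]) (auto simp: r_def field_simps)
      then show "dcone (Suc l) r \<subseteq> ?J"
        using cone_nested[OF levq lev(1)] mem_cone_self[of r "Suc l"] by auto
    qed
    then show ?thesis using lev by blast
  qed
qed

lemma ex_thin_cone:
  assumes f: "cone_exchange f"
  shows "\<exists>n r. lev n r \<and> thin f (dcone n r)"
proof -
  have z: "0 \<in> circ" "dyadic 0" using dyadic_iff_lev[of 0] by (auto simp: circ_def lev_def)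
  show ?thesis
  proof (cases "\<exists>m>0. (f ^^ m) 0 = 0")
    case False
    then show ?thesis using thin_cone_infinite_orbit[OF f z] by blast
  next
    case True
    define m where "m = (LEAST m. 0 < m \<and> (f ^^ m) 0 = 0)"
    have m: "0 < m" "(f ^^ m) 0 = 0"
      using True LeastI_ex[of "\<lambda>m. 0 < m \<and> (f ^^ m) 0 = 0"] by (simp_all add: m_def)
    have least: "(f ^^ i) 0 \<noteq> 0" if "0 < i" "i < m" for i
      using that not_less_Least[of i "\<lambda>m. 0 < m \<and> (f ^^ m) 0 = 0"] by (simp add: m_def)
    obtain n where "\<exists>a\<ge>0. \<exists>p. cone_map (f ^^ m) n 0 a p"
      using cone_exchange_deep[OF cone_exchange_funpow[OF f], of 0] by (metis lev_Ints Ints_0 order_refl)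
    then obtain a p where ap: "cone_map (f ^^ m) n 0 a p" by blast
    have "frac p = frac 0" using cone_map_app[OF ap] m by simp
    then have c: "cone_map (f ^^ m) n 0 a 0" using ap cone_map_cong[of 0 0 p 0] by blast
    show ?thesis
    proof (cases "n \<le> a")
      case True
      then show ?thesis using thin_cone_nonexpanding_periodic[OF f z(1) m(1) least c] by blast
    next
      case False
      \<comment> \<open>If the return map expands at 0, that of the inverse contracts, and thinness
        passes back from the inverse to \<open>f\<close>.\<close>
      let ?h = "inv_into UNIV f"
      have bij: "bij f" using cone_exchange_bij[OF f] .
      have h: "cone_exchange ?h" using cone_exchange_inverse[OF f] .
      have inv: "inv_into UNIV (f ^^ m) = ?h ^^ m"
        by (intro inv_unique_comp) (use funpow_inv_into[OF bij] in auto)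
      have hc: "cone_map (?h ^^ m) a 0 n 0"
        using cone_map_inverse[OF cone_exchange_funpow[OF f] c] inv by simp
      have "(?h ^^ i) 0 \<noteq> 0" if "0 < i" "i < m" for i
        using least[OF that] funpow_inv_into[OF bij] by metis
      then have "\<exists>n r. lev n r \<and> thin ?h (dcone n r)"
        using thin_cone_nonexpanding_periodic[OF h z(1) m(1) _ hc] False by simp
      then show ?thesis using thin_inverse[OF bij] by blast
    qed
  qed
qed

subsection \<open>Countability and group structure\<close>

text \<open>\<open>\<Phi>\<close> decodes an element from a source level and a finite list of target
  intervals, the pair \<open>(m, i)\<close> standing for level \<open>m\<close> and right end
  \<open>i / 2 ^ m\<close>.\<close>

lemma countable_thompsonV: "countable thompsonV"
proof -
  define \<Phi> :: "nat \<times> (nat \<times> int) list \<Rightarrow> real \<Rightarrow> real" where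
    "\<Phi> = (\<lambda>(N, ps) x. if x \<in> circ then
        let j = \<lceil>2 ^ N * x\<rceil>; (m, i) = ps ! nat j
        in frac (of_int i / 2 ^ m - (of_int j - 2 ^ N * x) / 2 ^ m) else x)"
  have "thompsonV \<subseteq> range \<Phi>"
  proof
    fix f assume "f \<in> thompsonV"
    then have f: "cone_exchange f" by (simp add: thompsonV_iff)
    then obtain N where N: "\<And>q. lev N q \<Longrightarrow> \<exists>m p. cone_map f N q m p"
      by (auto simp: cone_exchange_def)
    have "\<exists>mi. cone_map f N (of_int (int j) / 2 ^ N) (fst mi) (of_int (snd mi) / 2 ^ fst mi)" for j
    proof -
      obtain m p where mp: "cone_map f N (of_int (int j) / 2 ^ N) m p" using N[OF lev_int_div] by blast
      then obtain i where "2 ^ m * p = of_int i" by (auto simp: cone_map_def lev_def elim: Ints_cases)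
      then have "p = of_int i / 2 ^ m" by (simp add: field_simps)
      then show ?thesis using mp by (intro exI[of _ "(m, i)"]) simp
    qed
    then obtain d where d: "\<And>j. cone_map f N (of_int (int j) / 2 ^ N) (fst (d j)) (of_int (snd (d j)) / 2 ^ fst (d j))"
      by metis
    \<comment> \<open>The list has \<open>2 ^ N + 1\<close> entries because rounding up gives index
      0 at \<open>x = 0\<close> and index \<open>2 ^ N\<close> near 1, although both indices name
      the same interval of the circle.\<close>
    have "f = \<Phi> (N, map d [0..<2 ^ N + 1])"
    proof
      fix x
      show "f x = \<Phi> (N, map d [0..<2 ^ N + 1]) x"
      proof (cases "x \<in> circ")
        case False
        then show ?thesis using cone_exchange_outside[OF f] by (simp add: \<Phi>_def)
      next
        case True
        then have x: "0 \<le> x" "x < 1" by (auto simp: circ_def)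
        define j where "j = \<lceil>2 ^ N * x\<rceil>"
        have "0 \<le> 2 ^ N * x" "2 ^ N * x \<le> 2 ^ N" using x by simp_all
        then have "\<lceil>0::real\<rceil> \<le> j" "j \<le> \<lceil>2 ^ N :: real\<rceil>" unfolding j_def by (intro ceiling_mono; simp)+
        moreover have "\<lceil>2 ^ N :: real\<rceil> = 2 ^ N" by (metis ceiling_of_int of_int_numeral of_int_power)
        ultimately have j: "0 \<le> j" "j \<le> 2 ^ N" by simp_all
        then have "nat j \<le> 2 ^ N" by (simp add: nat_le_iff)
        then have lt: "nat j < 2 ^ N + 1 - 0" by linarith
        have nth: "map d [0..<2 ^ N + 1] ! nat j = d (nat j)" using nth_map_upt[OF lt, of d] by (metis add_0)
        define t where "t = of_int j - 2 ^ N * x"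
        have t: "0 \<le> t" "t < 1" unfolding t_def j_def by linarith+
        have "x = of_int (int (nat j)) / 2 ^ N - t / 2 ^ N" using j by (simp add: t_def field_simps)
        from cone_mapD[OF d t this] True
        have "f x = frac (of_int (snd (d (nat j))) / 2 ^ fst (d (nat j)) - t / 2 ^ fst (d (nat j)))" by simp
        then show ?thesis using True nth unfolding \<Phi>_def
          by (simp add: Let_def case_prod_beta t_def j_def del: upt_Suc)
      qed
    qed
    then show "f \<in> range \<Phi>" by blast
  qed
  then show ?thesis by (rule countable_subset) simp
qed

lemma mult_V_group: "f \<otimes>\<^bsub>V_group\<^esub> g = f \<circ> g"
  by (simp add: V_group_def)

lemma group_V_group: "group V_group"
proof (rule groupI)
  fix f assume "f \<in> carrier V_group"
  then have f: "cone_exchange f" by (simp add: V_group_def thompsonV_iff)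
  have "inv_into UNIV f \<circ> f = id" using cone_exchange_bij[OF f] by (simp add: bij_is_inj)
  then show "\<exists>g\<in>carrier V_group. g \<otimes>\<^bsub>V_group\<^esub> f = \<one>\<^bsub>V_group\<^esub>"
    using cone_exchange_inverse[OF f] by (auto simp: V_group_def thompsonV_iff)
qed (auto simp: V_group_def thompsonV_iff cone_exchange_id comp_assoc intro: cone_exchange_compose)

lemma inv_V_group:
  assumes "f \<in> thompsonV"
  shows "inv\<^bsub>V_group\<^esub> f = inv_into UNIV f"
proof (rule group.inv_equality[OF group_V_group])
  have f: "cone_exchange f" using assms by (simp add: thompsonV_iff)
  show "inv_into UNIV f \<otimes>\<^bsub>V_group\<^esub> f = \<one>\<^bsub>V_group\<^esub>"
    using cone_exchange_bij[OF f] by (simp add: V_group_def bij_is_inj)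
  show "f \<in> carrier V_group" "inv_into UNIV f \<in> carrier V_group"
    using f cone_exchange_inverse[OF f] by (auto simp: V_group_def thompsonV_iff)
qed

subsection \<open>Compressing the complement of an interval\<close>

definition rot :: "real \<Rightarrow> real \<Rightarrow> real" where
  "rot r x = (if x \<in> circ then frac (x + r) else x)"

lemma cone_exchange_rot:
  assumes "lev n r"
  shows "cone_exchange (rot r)"
proof -
  have "bij_betw (rot r) circ circ"
    by (rule bij_betw_byWitness[where f' = "rot (- r)"]) (auto simp: rot_def)
  moreover have "cone_map (rot r) n q n (q + r)" if "lev n q" for q
  proof -
    have "frac (q - t / 2 ^ n + r) = frac (q + r - t / 2 ^ n)" for t by (simp add: algebra_simps)
    then show ?thesis using that assms by (simp add: cone_map_def rot_def lev_add)
  qed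
  ultimately show ?thesis unfolding cone_exchange_def by (auto simp: rot_def)
qed

text \<open>A standard generator of Thompson's group F, repelling from 0 on the right and attracting to
  1 on the left.\<close>

definition stretch :: "real \<Rightarrow> real" where
  "stretch x = (if x \<in> circ then
     (if x \<le> 1 / 4 then 2 * x else if x \<le> 1 / 2 then x + 1 / 4 else (x + 1) / 2) else x)"

lemma cone_map_stretch:
  "cone_map stretch 2 (1 / 4) 1 (1 / 2)" "cone_map stretch 2 (1 / 2) 2 (3 / 4)"
  "cone_map stretch 2 (3 / 4) 3 (7 / 8)" "cone_map stretch 2 1 3 1"
proof -
  have fr: "frac x = x" if "0 \<le> x" "x < 1" for x :: real using that by (simp add: frac_eq)
  show "cone_map stretch 2 (1 / 4) 1 (1 / 2)" "cone_map stretch 2 (1 / 2) 2 (3 / 4)"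
    "cone_map stretch 2 (3 / 4) 3 (7 / 8)"
    by (auto simp: cone_map_def lev_def fr stretch_def circ_def field_simps)
  \<comment> \<open>The right end 1 of the last quarter is the circle point 0, which
    \<open>stretch\<close> fixes; hence the separate case \<open>t = 0\<close>.\<close>
  have "stretch (frac (1 - t / 4)) = frac (1 - t / 8)" if "0 \<le> t" "t < 1" for t
    using that by (cases "t = 0") (auto simp: fr stretch_def circ_def field_simps)
  then show "cone_map stretch 2 1 3 1" by (simp add: cone_map_def lev_def)
qed

lemma cone_exchange_stretch: "cone_exchange stretch"
proof -
  have "bij_betw stretch circ circ"
    by (rule bij_betw_byWitness[where
          f' = "\<lambda>y. if y \<le> 1 / 2 then y / 2 else if y \<le> 3 / 4 then y - 1 / 4 else 2 * y - 1"])
      (auto simp: stretch_def circ_def field_simps)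
  moreover have "\<exists>m p. cone_map stretch 2 q m p" if q: "lev 2 q" for q
  proof -
    have "4 * frac q \<in> \<int>" using q lev_frac[of 2 q] by (simp add: lev_def)
    then obtain z where z: "4 * frac q = of_int z" by (auto elim: Ints_cases)
    have "0 \<le> 4 * frac q" "4 * frac q < 4" using frac_lt_1[of q] by auto
    then have "z \<in> {0, 1, 2, 3}" unfolding z by auto
    then have "frac q \<in> {0, 1 / 4, 1 / 2, 3 / 4}" using z by auto
    moreover have "frac (1 / 4) = (1 / 4 :: real)" "frac (1 / 2) = (1 / 2 :: real)" "frac (3 / 4) = (3 / 4 :: real)"
      by (simp_all add: frac_eq)
    ultimately obtain q' where "frac q = frac q'" "q' \<in> {1, 1 / 4, 1 / 2, 3 / 4}"
      by (metis frac_1 insertE insertI1 insertI2 singletonD)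
    then show ?thesis using cone_map_stretch cone_map_cong[OF \<open>frac q = frac q'\<close> refl] by blast
  qed
  ultimately show ?thesis unfolding cone_exchange_def by (auto simp: stretch_def)
qed

lemma stretch_circ: "x \<in> circ \<Longrightarrow> (stretch ^^ k) x \<in> circ"
  using cone_exchange_circ[OF cone_exchange_funpow[OF cone_exchange_stretch]] by blast

text \<open>Each step doubles the lower bound until it reaches \<open>1 / 2\<close>. The fixed point
  0 is kept apart, as it stands for the right end 1.\<close>

lemma stretch_away_from_zero:
  "x \<in> circ \<Longrightarrow> x = 0 \<or> x > 1 / 2 ^ Suc k \<Longrightarrow> (stretch ^^ k) x = 0 \<or> (stretch ^^ k) x > 1 / 2"
proof (induction k arbitrary: x)
  case 0
  then show ?case by simp
next
  case (Suc k)
  define d :: real where "d = 1 / 2 ^ Suc k"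
  have "(1::real) \<le> 2 ^ k" by simp
  then have "d \<le> 1 / 2" by (simp add: d_def field_simps)
  moreover have "x = 0 \<or> x > d / 2" using Suc.prems by (simp add: d_def)
  ultimately have "stretch x = 0 \<or> stretch x > d"
    using Suc.prems(1) by (auto simp: stretch_def)
  then have "stretch x = 0 \<or> stretch x > 1 / 2 ^ Suc k" unfolding d_def .
  moreover have "stretch x \<in> circ" using stretch_circ[of x 1] Suc.prems by simp
  ultimately show ?case using Suc.IH by (simp add: funpow_swap1)
qed

text \<open>Beyond \<open>1 / 2\<close> each step halves the distance to 1.\<close>

lemma stretch_towards_one:
  assumes "x \<in> circ" "x = 0 \<or> x > 1 / 2"
  shows "(stretch ^^ k) x = 0 \<or> (stretch ^^ k) x > 1 - 1 / 2 ^ Suc k"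
proof (induction k)
  case 0
  then show ?case using assms by simp
next
  case (Suc k)
  define y where "y = (stretch ^^ k) x"
  define d :: real where "d = 1 / 2 ^ Suc k"
  have "(1::real) \<le> 2 ^ k" by simp
  then have "d \<le> 1 / 2" by (simp add: d_def field_simps)
  moreover have "y \<in> circ" using assms stretch_circ by (simp add: y_def)
  moreover have "y = 0 \<or> y > 1 - d" using Suc by (simp add: y_def d_def)
  ultimately have "stretch y = 0 \<or> stretch y > 1 - d / 2"
    by (auto simp: stretch_def)
  then show ?case by (simp add: y_def d_def)
qed

text \<open>A rotation moves \<open>dcone k u\<close> onto the interval from 0 to
  \<open>1 / 2 ^ k\<close>. Then \<open>k\<close> steps of \<open>stretch\<close> push the
  complement beyond \<open>1 / 2\<close>, \<open>n\<close> further steps push it close to 1, and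
  rotation by \<open>r\<close> carries it into \<open>dcone n r\<close>.\<close>

lemma ex_compressing:
  assumes I: "lev n r" and U: "lev k u"
  shows "\<exists>g. cone_exchange g \<and> (\<forall>x\<in>circ - dcone k u. g x \<in> dcone n r)"
proof -
  define g where "g = rot r \<circ> (stretch ^^ n) \<circ> (stretch ^^ k) \<circ> rot (1 / 2 ^ k - u)"
  have "lev k (1 / 2 ^ k - u)" using U lev_inv_power lev_diff by blast
  then have "cone_exchange g"
    unfolding g_def using I
    by (intro cone_exchange_compose cone_exchange_funpow cone_exchange_stretch cone_exchange_rot)
  moreover have "g x \<in> dcone n r" if x: "x \<in> circ - dcone k u" for x
  proof -
    define y1 where "y1 = frac (x + (1 / 2 ^ k - u))"
    have y1: "y1 = 0 \<or> y1 > 1 / 2 ^ k"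
    proof (rule ccontr)
      assume "\<not> ?thesis"
      then have a: "0 < y1" "y1 \<le> 1 / 2 ^ k" using frac_ge_0[of "x + (1 / 2 ^ k - u)"] by (auto simp: y1_def)
      define z :: real where "z = of_int \<lfloor>x + (1 / 2 ^ k - u)\<rfloor>"
      have "y1 = x + (1 / 2 ^ k - u) - z" by (simp add: y1_def z_def frac_def)
      then have "0 \<le> u - x + z" "u - x + z < 1 / 2 ^ k" using a by linarith+
      moreover have "z \<in> \<int>" by (simp add: z_def)
      ultimately have "frac x \<in> dcone k u" unfolding mem_cone_iff by blast
      then show False using x by simp
    qed
    have "(1::real) / 2 ^ Suc k \<le> 1 / 2 ^ k" by (simp add: field_simps)
    then have y1': "y1 = 0 \<or> y1 > 1 / 2 ^ Suc k" using y1 by linarith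
    have c1: "y1 \<in> circ" by (simp add: y1_def)
    define y2 where "y2 = (stretch ^^ k) y1"
    have y2: "y2 \<in> circ" "y2 = 0 \<or> y2 > 1 / 2"
      using stretch_circ[OF c1] stretch_away_from_zero[OF c1 y1'] by (simp_all add: y2_def)
    define y3 where "y3 = (stretch ^^ n) y2"
    have y3: "y3 \<in> circ" "y3 = 0 \<or> y3 > 1 - 1 / 2 ^ Suc n"
      using stretch_circ[OF y2(1)] stretch_towards_one[OF y2] by (simp_all add: y3_def)
    have "(1::real) / 2 ^ Suc n \<le> 1 / 2 ^ n" by (simp add: field_simps)
    then have "y3 = 0 \<or> 0 \<le> 1 - y3 \<and> 1 - y3 < 1 / 2 ^ n"
      using y3 by (auto simp: circ_def)
    then have "\<exists>z\<in>\<int>. 0 \<le> r - (y3 + r) + z \<and> r - (y3 + r) + z < 1 / 2 ^ n"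
    proof
      assume "y3 = 0"
      then show ?thesis by (intro bexI[of _ 0]) auto
    next
      assume "0 \<le> 1 - y3 \<and> 1 - y3 < 1 / 2 ^ n"
      then show ?thesis by (intro bexI[of _ 1]) auto
    qed
    then have "frac (y3 + r) \<in> dcone n r" unfolding mem_cone_iff .
    moreover have "g x = frac (y3 + r)"
    proof -
      have "rot (1 / 2 ^ k - u) x = y1" using x by (simp add: rot_def y1_def)
      then have "g x = rot r y3" by (simp add: g_def y2_def y3_def)
      then show ?thesis using y3 by (simp add: rot_def)
    qed
    ultimately show ?thesis by simp
  qed
  ultimately show ?thesis by blast
qed

subsection \<open>Ping-pong\<close>

text \<open>The label of a reached point is the index of the last relation that moved it.\<close>

inductive reach :: "('i \<Rightarrow> 'a \<Rightarrow> 'a \<Rightarrow> bool) \<Rightarrow> 'a \<Rightarrow> 'i option \<Rightarrow> 'a \<Rightarrow> bool" for E x0 where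
  start: "reach E x0 None x0"
| step: "reach E x0 l y \<Longrightarrow> l \<noteq> Some i \<Longrightarrow> E i y z \<Longrightarrow> z \<noteq> y \<Longrightarrow> reach E x0 (Some i) z"

text \<open>The invariant is that a point with label \<open>i\<close> lies in \<open>U i\<close>.
  Its predecessor is the start or lies in a disjoint \<open>U j\<close>, so the move begins outside
  \<open>U i\<close>, and \<open>thin\<close> forces it to end inside.\<close>

lemma ping_pong:
  assumes trans: "\<And>i x y z. E i x y \<Longrightarrow> E i y z \<Longrightarrow> E i x z"
    and disj: "\<And>i j. i \<noteq> j \<Longrightarrow> U i \<inter> U j = {}"
    and thin: "\<And>i x y. E i x y \<Longrightarrow> x \<notin> U i \<Longrightarrow> y \<notin> U i \<Longrightarrow> x = y"
    and x0: "\<And>i. x0 \<notin> U i"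
    and walk: "(\<lambda>x y. \<exists>i. E i x y)\<^sup>*\<^sup>* x0 w" and w: "\<And>i. w \<notin> U i"
  shows "w = x0"
proof -
  have inv: "case l of None \<Rightarrow> y = x0 | Some i \<Rightarrow> y \<in> U i" if "reach E x0 l y" for l y
    using that
  proof induction
    case (step l y i z)
    then have "y \<notin> U i" using x0 disj by (cases l) auto
    then have "z \<in> U i" using thin step.hyps by metis
    then show ?case by simp
  qed simp
  have closed: "\<exists>l'. reach E x0 l' z" if yz: "reach E x0 l y" "E i y z" for l y i z
  proof (cases "l = Some i")
    case True
    \<comment> \<open>Two consecutive moves of the same relation merge into one move from the
      earlier point \<open>y'\<close>, so consecutive labels stay different.\<close>
    then obtain l' y' where "reach E x0 l' y'" "l' \<noteq> Some i" "E i y' y"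
      using yz(1) by (auto elim: reach.cases)
    then show ?thesis using trans yz(2) reach.step by metis
  next
    case False
    then show ?thesis using yz reach.step by metis
  qed
  have "\<exists>l. reach E x0 l w"
    using walk by induction (use closed in \<open>blast intro: reach.start\<close>)+
  then obtain l where "reach E x0 l w" by blast
  from inv[OF this] show ?thesis using w by (cases l) auto
qed

text \<open>On the line this is \<open>(1 / 2 ^ (i + 2), 1 / 2 ^ (i + 1)]\<close>. Infinitely many
  disjoint intervals thus fit between 0 and \<open>1 / 2\<close>, and they leave 0 and
  \<open>3 / 4\<close> uncovered.\<close>

definition slot :: "nat \<Rightarrow> real set" where
  "slot i = dcone (i + 2) (1 / 2 ^ (i + 1))"

lemma slot_bounds:
  assumes "x \<in> slot i"
  shows "1 / 2 ^ (i + 2) < x" "x \<le> 1 / 2 ^ (i + 1)"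
proof -
  obtain t where t: "x = frac (1 / 2 ^ (i + 1) - t / 2 ^ (i + 2))" "0 \<le> t" "t < 1"
    using assms by (auto simp: slot_def dcone_def)
  have e: "1 / 2 ^ (i + 1) - t / 2 ^ (i + 2) = (2 - t) / 2 ^ (i + 2)" by (simp add: field_simps)
  have "(2 - t) / 2 ^ (i + 2) < 1"
  proof -
    have "(1::real) \<le> 2 ^ i" by simp
    moreover have "(2::real) ^ (i + 2) = 4 * 2 ^ i" by simp
    ultimately have "2 - t < 2 ^ (i + 2)" using t(2) by linarith
    then show ?thesis by simp
  qed
  then have x: "x = (2 - t) / 2 ^ (i + 2)" using t e by (simp add: frac_eq del: power_add)
  show "1 / 2 ^ (i + 2) < x" "x \<le> 1 / 2 ^ (i + 1)"
    unfolding x using t by (simp_all add: field_simps)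
qed

lemma slot_disjoint:
  assumes "i \<noteq> j"
  shows "slot i \<inter> slot j = {}"
proof -
  have "slot i \<inter> slot j = {}" if ij: "i < j" for i j
  proof -
    have "(2::real) ^ (i + 2) \<le> 2 ^ (j + 1)" using ij by (intro power_increasing) auto
    then have "1 / 2 ^ (j + 1) \<le> (1 / 2 ^ (i + 2) :: real)" by (simp add: frac_le)
    then show ?thesis using slot_bounds[of _ i] slot_bounds[of _ j] by fastforce
  qed
  then show ?thesis using assms by (metis inf_commute nat_neq_iff)
qed

lemma slot_le_half: "x \<in> slot i \<Longrightarrow> 0 < x \<and> x \<le> 1 / 2"
proof -
  assume x: "x \<in> slot i"
  have "0 < (1 / 2 ^ (i + 2) :: real)" by simp
  moreover have "(1::real) \<le> 2 ^ i" by simp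
  then have "1 / 2 ^ (i + 1) \<le> (1 / 2 :: real)" by (simp add: field_simps)
  ultimately show ?thesis using slot_bounds[OF x] by linarith
qed

text \<open>\<open>g\<close> carries orbits of the conjugate to orbits of \<open>f\<close>. Equal
  iterates mean a common orbit, and cancelling the smaller power by injectivity yields a forward
  return to \<open>I\<close>.\<close>

lemma thin_conjugate:
  assumes f: "inj f" and g: "bij g" and I: "thin f I"
    and x: "g x \<in> I" and y: "g y \<in> I"
    and eq: "((inv_into UNIV g \<circ> f \<circ> g) ^^ m) x = ((inv_into UNIV g \<circ> f \<circ> g) ^^ n) y"
  shows "x = y"
proof -
  have gi: "g (inv_into UNIV g z) = z" for z using g by (simp add: bij_is_surj surj_f_inv_f)
  have pow: "g (((inv_into UNIV g \<circ> f \<circ> g) ^^ k) z) = (f ^^ k) (g z)" for k z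
    by (induction k) (simp_all add: gi)
  have e: "(f ^^ m) (g x) = (f ^^ n) (g y)" using eq pow by metis
  have *: "v = w" if vw: "v \<in> I" "w \<in> I" "(f ^^ a) v = (f ^^ b) w" "a \<le> b" for v w a b
  proof -
    have "(f ^^ b) w = (f ^^ a) ((f ^^ (b - a)) w)"
      using vw(4) funpow_add[of a "b - a" f] by (simp add: fun_eq_iff)
    then have "v = (f ^^ (b - a)) w" using vw(3) inj_fn[OF f] injD by metis
    then show ?thesis using I vw unfolding thin_def by metis
  qed
  have "g x = g y" using *[OF x y e] *[OF y x e[symmetric]] by (cases "m \<le> n") auto
  then show ?thesis using g by (simp add: bij_is_inj inj_eq)
qed

theorem theorem4p7:
  shows "\<not> invariably_generated V_group"
proof
  assume "invariably_generated V_group"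
  then obtain S where S: "S \<subseteq> thompsonV" and
    gen: "\<And>g. g \<in> S \<rightarrow> thompsonV \<Longrightarrow>
        generate V_group ((\<lambda>s. inv\<^bsub>V_group\<^esub> (g s) \<otimes>\<^bsub>V_group\<^esub> s \<otimes>\<^bsub>V_group\<^esub> g s) ` S) = thompsonV"
    unfolding invariably_generated_def by (auto simp: V_group_def)
  \<comment> \<open>Countability gives each element of \<open>S\<close> a slot of its own.\<close>
  have "countable S" using S countable_thompsonV countable_subset by blast
  then have inj: "inj_on (to_nat_on S) S" by (rule inj_on_to_nat_on)
  define U where "U s = slot (to_nat_on S s)" for s
  have "\<forall>s\<in>S. \<exists>g n r. cone_exchange g \<and> thin s (dcone n r) \<and> (\<forall>x\<in>circ - U s. g x \<in> dcone n r)"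
  proof
    fix s assume "s \<in> S"
    then have "cone_exchange s" using S thompsonV_iff by blast
    then obtain n r where nr: "lev n r" "thin s (dcone n r)" using ex_thin_cone by blast
    have "lev (to_nat_on S s + 2) (1 / 2 ^ (to_nat_on S s + 1))"
      by (rule lev_mono[OF lev_inv_power]) simp
    from ex_compressing[OF nr(1) this] nr(2)
    show "\<exists>g n r. cone_exchange g \<and> thin s (dcone n r) \<and> (\<forall>x\<in>circ - U s. g x \<in> dcone n r)"
      unfolding U_def slot_def by blast
  qed
  then obtain g n r where g: "\<And>s. s \<in> S \<Longrightarrow> cone_exchange (g s)"
    and th: "\<And>s. s \<in> S \<Longrightarrow> thin s (dcone (n s) (r s))"
    and comp: "\<And>s x. s \<in> S \<Longrightarrow> x \<in> circ - U s \<Longrightarrow> g s x \<in> dcone (n s) (r s)"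
    by metis
  define c where "c s = inv_into UNIV (g s) \<circ> s \<circ> g s" for s
  define C where "C = c ` S"
  have gV: "g s \<in> thompsonV" if "s \<in> S" for s using g[OF that] by (simp add: thompsonV_iff)
  have ce: "cone_exchange (c s)" if "s \<in> S" for s
    using g[OF that] S that cone_exchange_inverse thompsonV_iff
    by (auto simp: c_def intro!: cone_exchange_compose)
  have "(\<lambda>s. inv\<^bsub>V_group\<^esub> (g s) \<otimes>\<^bsub>V_group\<^esub> s \<otimes>\<^bsub>V_group\<^esub> g s) ` S = C"
    unfolding C_def by (rule image_cong) (auto simp: inv_V_group[OF gV] c_def mult_V_group)
  then have genC: "generate V_group C = thompsonV" using gen[of g] gV by auto
  \<comment> \<open>Since \<open>c s\<close> is bijective, equality of some iterates with
    natural-number exponents expresses that two points share a full orbit, inverses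
    included.\<close>
  define E where "E s x y \<longleftrightarrow> s \<in> S \<and> x \<in> circ \<and> y \<in> circ \<and> (\<exists>m n. (c s ^^ m) x = (c s ^^ n) y)" for s x y
  have walk: "h x \<in> circ \<and> (\<lambda>x y. \<exists>s. E s x y)\<^sup>*\<^sup>* x (h x)" if "h \<in> generate V_group C" "x \<in> circ" for h x
    using that
  proof (induction arbitrary: x rule: generate.induct)
    case one
    then show ?case by (simp add: V_group_def)
  next
    case (incl h)
    then obtain s where s: "s \<in> S" "h = c s" by (auto simp: C_def)
    then have "h x \<in> circ" using cone_exchange_circ[OF ce] incl by simp
    moreover have "(c s ^^ 1) x = (c s ^^ 0) (h x)" using s by simp
    ultimately have "E s x (h x)" using s incl unfolding E_def by blast
    then show ?case using \<open>h x \<in> circ\<close> by blast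
  next
    case (inv h)
    then obtain s where s: "s \<in> S" "h = c s" by (auto simp: C_def)
    have h: "cone_exchange h" using ce s by simp
    have i: "inv\<^bsub>V_group\<^esub> h = inv_into UNIV h" by (rule inv_V_group) (use h thompsonV_iff in blast)
    let ?y = "inv_into UNIV h x"
    have "h ?y = x" using cone_exchange_bij[OF h] by (simp add: bij_is_surj surj_f_inv_f)
    then have "(c s ^^ 0) x = (c s ^^ 1) ?y" using s by simp
    moreover have y: "?y \<in> circ" using cone_exchange_circ[OF cone_exchange_inverse[OF h]] inv by simp
    ultimately have "E s x ?y" using s inv unfolding E_def by blast
    then show ?case unfolding i using y by blast
  next
    case (eng h1 h2)
    have "(h1 \<otimes>\<^bsub>V_group\<^esub> h2) x = h1 (h2 x)" by (simp add: V_group_def)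
    then show ?case using eng.IH(2)[OF eng.prems] eng.IH(1)[of "h2 x"] by (metis rtranclp_trans)
  qed
  \<comment> \<open>This rotation belongs to V and joins two points that lie outside every
    slot.\<close>
  have "lev 2 (3 / 4)" by (simp add: lev_def)
  then have "rot (3 / 4) \<in> generate V_group C"
    using genC cone_exchange_rot thompsonV_iff by blast
  moreover have "rot (3 / 4) 0 = 3 / 4" "0 \<in> circ" by (simp_all add: rot_def circ_def frac_eq)
  ultimately have "(\<lambda>x y. \<exists>s. E s x y)\<^sup>*\<^sup>* 0 (3 / 4)" using walk by metis
  \<comment> \<open>The numbering is injective only on \<open>S\<close>; empty sets elsewhere keep
    the whole family disjoint.\<close>
  define W where "W s = (if s \<in> S then U s else {})" for s
  have "(3 / 4 :: real) = 0"
  proof (rule ping_pong[of E W])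
    fix s x y z assume "E s x y" "E s y z"
    then obtain a b d e where *: "(c s ^^ a) x = (c s ^^ b) y" "(c s ^^ d) y = (c s ^^ e) z"
      and s: "s \<in> S" "x \<in> circ" "z \<in> circ" by (auto simp: E_def)
    \<comment> \<open>The two equations are aligned at \<open>y\<close> by applying the power
      \<open>d\<close> to the first and the power \<open>b\<close> to the second.\<close>
    have "(c s ^^ (d + a)) x = (c s ^^ (d + b)) y" by (simp add: funpow_add *(1))
    also have "\<dots> = (c s ^^ (b + d)) y" by (simp add: add.commute)
    also have "\<dots> = (c s ^^ (b + e)) z" by (simp add: funpow_add *(2))
    finally show "E s x z" using s unfolding E_def by blast
  next
    fix s t :: "real \<Rightarrow> real" assume "s \<noteq> t"
    then show "W s \<inter> W t = {}"
      using inj slot_disjoint[of "to_nat_on S s" "to_nat_on S t"] by (auto simp: W_def U_def inj_on_def)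
  next
    fix s x y assume xy: "E s x y" "x \<notin> W s" "y \<notin> W s"
    then have s: "s \<in> S" by (simp add: E_def)
    from xy obtain a b where eq: "(c s ^^ a) x = (c s ^^ b) y" by (auto simp: E_def)
    have "inj s" using s S thompsonV_iff cone_exchange_bij bij_is_inj by blast
    moreover have "g s x \<in> dcone (n s) (r s)" "g s y \<in> dcone (n s) (r s)"
      using comp[OF s] xy s by (auto simp: E_def W_def)
    ultimately show "x = y"
      using thin_conjugate[OF _ cone_exchange_bij[OF g[OF s]] th[OF s]] eq unfolding c_def by blast
  next
    fix s show "0 \<notin> W s" "3 / 4 \<notin> W s" using slot_le_half[of 0] slot_le_half[of "3 / 4"] by (auto simp: W_def U_def)
  next
    show "(\<lambda>x y. \<exists>s. E s x y)\<^sup>*\<^sup>* 0 (3 / 4)" by fact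
  qed
  then show False by simp
qed

end
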